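(* Let $\lambda,\mu\in\mathbb{R}$ with $\lambda^2+\mu^2\neq0$, let $A=\begin{pmatrix}\lambda&-\mu\\\mu&\lambda\end{pmatrix}$, $\theta=\begin{pmatrix}0&-1\\1&0\end{pmatrix}$, let $\eta\in\mathbb{R}^2$ be nonzero, let $\Omega=[u^-,u^+]$ with $u^-<0<u^+$, and consider the control-affine system on $\mathbb{R}^2$ $$\dot v=(A-u\theta)v+u\eta,\qquad u\in\Omega. $$ For $u\in\Omega$ with $\det(A-u\theta)\neq0$ let $v(u)=-u(A-u\theta)^{-1}\eta$. Then the system admits a unique control set $\mathcal{C}_{\mathbb{R}^2}$ with nonempty interior; it is bounded if $\operatorname{tr}A\neq0$. Moreover: 1. if $\operatorname{tr}A=0$, then $\mathcal{C}_{\mathbb{R}^2}=\mathbb{R}^2$; 2. if $\operatorname{tr}A<0$, then $\mathcal{C}_{\mathbb{R}^2}=\overline{\mathcal{O}^+(v(u))}$ for all $u\in\Omega$; 3. if $\operatorname{tr}A>0$, then $\mathcal{C}_{\mathbb{R}^2}=\mathcal{O}^-(v(u))$ for all $u\in\Omega$ with $u\neq\mu$.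
   Context: The admissible controls $\mathcal{U}$ are the piecewise constant functions $\mathbf{u}:\mathbb{R}\to\Omega$, and $\varphi(\cdot,x,\mathbf{u})$ denotes the solution of the system with control $\mathbf{u}$ and $\varphi(0,x,\mathbf{u})=x$. The positive and negative orbits of $x$ are $\mathcal{O}^+(x)=\{\varphi(t,x,\mathbf{u}): t\ge0,\ \mathbf{u}\in\mathcal{U}\}$ and $\mathcal{O}^-(x)=\{\varphi(-t,x,\mathbf{u}): t\ge0,\ \mathbf{u}\in\mathcal{U}\}$. A control set is a set $D$ that is maximal with respect to set inclusion among the sets satisfying: (1) for every $x\in D$ there is $\mathbf{u}\in\mathcal{U}$ with $\varphi(\mathbb{R}_+,x,\mathbf{u})\subset D$; (2) $D\subset\overline{\mathcal{O}^+(x)}$ for every $x\in D$. Note that $\operatorname{tr}A=2\lambda$ and $\det(A-u\theta)=\lambda^2+(\mu-u)^2$, so $v(u)$ is defined for all $u\in\Omega$ when $\operatorname{tr}A\neq 0$. *)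

theory Defs
  imports "HOL-Analysis.Analysis"
begin

(* A control system  v' = f v u  is given by its right-hand side f, where u is the control value. *)

(* S is the set of switching times; only finitely many of them lie in any bounded interval,
   and the values taken at the switching times are unconstrained. *)
definition piecewise_constant :: "(real \<Rightarrow> real) \<Rightarrow> bool" where
  "piecewise_constant u \<longleftrightarrow>
     (\<exists>S. (\<forall>a b. finite (S \<inter> {a..b})) \<and>
          (\<forall>I. connected I \<and> I \<inter> S = {} \<longrightarrow> u constant_on I))"

definition admissible :: "real set \<Rightarrow> (real \<Rightarrow> real) set" where
  "admissible \<Omega> = {u. piecewise_constant u \<and> range u \<subseteq> \<Omega>}"

(* For a discontinuous control the solution is continuous, and satisfies the differential
   equation at every time at which the control is continuous. *)
definition is_solution ::
  "('a::real_normed_vector \<Rightarrow> real \<Rightarrow> 'a) \<Rightarrow> 'a \<Rightarrow> (real \<Rightarrow> real) \<Rightarrow> (real \<Rightarrow> 'a) \<Rightarrow> bool" where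
  "is_solution f x u \<gamma> \<longleftrightarrow>
     continuous_on UNIV \<gamma> \<and> \<gamma> 0 = x \<and>
     (\<forall>t. isCont u t \<longrightarrow> (\<gamma> has_vector_derivative f (\<gamma> t) (u t)) (at t))"

(* THE is meaningful when solutions exist globally and are unique, as they do for systems that
   are affine in the state, with a piecewise constant control. *)
definition flow ::
  "('a::real_normed_vector \<Rightarrow> real \<Rightarrow> 'a) \<Rightarrow> real \<Rightarrow> 'a \<Rightarrow> (real \<Rightarrow> real) \<Rightarrow> 'a" where
  "flow f t x u = (THE \<gamma>. is_solution f x u \<gamma>) t"

definition pos_orbit ::
  "('a::real_normed_vector \<Rightarrow> real \<Rightarrow> 'a) \<Rightarrow> real set \<Rightarrow> 'a \<Rightarrow> 'a set" where
  "pos_orbit f \<Omega> x = {flow f t x u | t u. t \<ge> 0 \<and> u \<in> admissible \<Omega>}"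

definition neg_orbit ::
  "('a::real_normed_vector \<Rightarrow> real \<Rightarrow> 'a) \<Rightarrow> real set \<Rightarrow> 'a \<Rightarrow> 'a set" where
  "neg_orbit f \<Omega> x = {flow f (- t) x u | t u. t \<ge> 0 \<and> u \<in> admissible \<Omega>}"

definition pre_control_set ::
  "('a::real_normed_vector \<Rightarrow> real \<Rightarrow> 'a) \<Rightarrow> real set \<Rightarrow> 'a set \<Rightarrow> bool" where
  "pre_control_set f \<Omega> D \<longleftrightarrow>
     (\<forall>x\<in>D. \<exists>u\<in>admissible \<Omega>. (\<lambda>t. flow f t x u) ` {0..} \<subseteq> D) \<and>
     (\<forall>x\<in>D. D \<subseteq> closure (pos_orbit f \<Omega> x))"

definition control_set ::
  "('a::real_normed_vector \<Rightarrow> real \<Rightarrow> 'a) \<Rightarrow> real set \<Rightarrow> 'a set \<Rightarrow> bool" where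
  "control_set f \<Omega> D \<longleftrightarrow>
     pre_control_set f \<Omega> D \<and>
     (\<forall>D'. pre_control_set f \<Omega> D' \<and> D \<subseteq> D' \<longrightarrow> D' = D)"

definition A_mat :: "real \<Rightarrow> real \<Rightarrow> real^2^2" where
  "A_mat lam mu = vector [vector [lam, - mu], vector [mu, lam]]"

definition theta :: "real^2^2" where
  "theta = vector [vector [0, - 1], vector [1, 0]]"

definition affine_rhs :: "real^2^2 \<Rightarrow> real^2 \<Rightarrow> real^2 \<Rightarrow> real \<Rightarrow> real^2" where
  "affine_rhs A \<eta> v u = (A - u *\<^sub>R theta) *v v + u *\<^sub>R \<eta>"

(* The equilibrium v(u); only meaningful when det (A - u theta) is nonzero, since matrix_inv
   is unspecified on singular matrices. *)
definition equilibrium :: "real^2^2 \<Rightarrow> real^2 \<Rightarrow> real \<Rightarrow> real^2" where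
  "equilibrium A \<eta> u = - (u *\<^sub>R (matrix_inv (A - u *\<^sub>R theta) *v \<eta>))"

end

theory Submission
  imports Defs
begin

text \<open>
  Identify the plane with \<open>\<complex>\<close>. The system becomes \<open>v' = c(u) v + u \<eta>\<close> with the scalar
  \<open>c(u) = \<lambda> + \<i> (\<mu> - u)\<close>, so every control acts by affine maps \<open>x \<mapsto> a x + b\<close> of \<open>\<complex>\<close>, and after
  time \<open>t\<close> the modulus of \<open>a\<close> is \<open>exp (\<lambda> t)\<close> whatever the control was. A constant control \<open>u \<noteq> \<mu>\<close>
  moves points along logarithmic spirals (circles if \<open>\<lambda> = 0\<close>) around \<open>v(u)\<close>.

  Undamped case \<open>\<lambda> = 0\<close>. Two different controls give full rotations about two different centres.
  Alternating them changes the distance to the first centre by any amount up to twice the distance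
  of the centres, and rotations can be undone by going on turning, so every point reaches every
  other point.

  Local controllability for \<open>\<lambda> \<noteq> 0\<close>. Let \<open>u \<noteq> \<mu>\<close>, so that control \<open>u\<close> turns around \<open>v(u)\<close>. A second
  control moves \<open>v(u)\<close> along an arc, and switching back to \<open>u\<close> sweeps the arc along spirals. In
  logarithmic coordinates centred at \<open>v(u)\<close> the spirals are parallel lines and the arc is a curve
  that runs off to infinity, so by the intermediate value theorem it meets the spiral of every point
  (\<open>spiral_meets_arc\<close>). Keeping track of the sign of the time spent on the spiral yields: \<open>v(u)\<close> is
  interior to its positive orbit if \<open>\<lambda> < 0\<close>; it is interior to its negative orbit and reaches the
  whole plane if \<open>\<lambda> > 0\<close>.

  Contracting case \<open>\<lambda> < 0\<close>. Every orbit comes arbitrarily close to every \<open>v(u)\<close>, so the closed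
  positive orbits of the equilibria coincide in one forward invariant set \<open>C\<close>, which is contained in
  every closed positive orbit. The distance to \<open>C\<close> shrinks at least by the factor \<open>exp (\<lambda> t)\<close>, so
  that a point off \<open>C\<close> cannot be approached again from its own future; hence every set with the two
  defining properties of a control set lies in \<open>C\<close>.

  Expanding case \<open>\<lambda> > 0\<close>. Now \<open>R\<close>, the negative orbit of \<open>v(u)\<close> for some \<open>u \<noteq> \<mu>\<close>, is open, and each
  of its points reaches the whole plane. The distance to the closure of \<open>R\<close> grows in forward time,
  so a set with the two defining properties lies in this closure. If its interior is nonempty, it
  meets the open set \<open>R\<close>, and then all its points can be steered into \<open>R\<close>, which puts them in \<open>R\<close>.
\<close>

section \<open>Piecewise constant controls\<close>

text \<open>
  The witness hidden in the definition of piecewise constancy, made accessible because shifting and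
  concatenating controls must say which switching times result.
\<close>
definition switching_times :: "(real \<Rightarrow> real) \<Rightarrow> real set \<Rightarrow> bool" where
  "switching_times u S \<longleftrightarrow>
     (\<forall>a b. finite (S \<inter> {a..b})) \<and> (\<forall>I. connected I \<and> I \<inter> S = {} \<longrightarrow> u constant_on I)"

lemma piecewise_constant_iff: "piecewise_constant u \<longleftrightarrow> (\<exists>S. switching_times u S)"
  by (simp add: piecewise_constant_def switching_times_def)

lemma locally_finite_imp_countable:
  fixes S :: "real set"
  assumes "\<And>a b. finite (S \<inter> {a..b})"
  shows "countable S"
proof -
  have "S = (\<Union>n::nat. S \<inter> {- real n..real n})"
  proof (intro equalityI subsetI)
    fix x assume "x \<in> S"
    moreover obtain n where "\<bar>x\<bar> \<le> real n"
      using real_arch_simple by blast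
    ultimately show "x \<in> (\<Union>n::nat. S \<inter> {- real n..real n})"
      by (auto intro!: exI[of _ n])
  qed auto
  moreover have "countable (\<Union>n::nat. S \<inter> {- real n..real n})"
    using assms by (intro countable_UN) (auto intro: countable_finite)
  ultimately show ?thesis by simp
qed

lemma locally_finite_avoid:
  fixes S :: "real set"
  assumes "\<And>a b. finite (S \<inter> {a..b})" "t \<notin> S"
  obtains e where "e > 0" "ball t e \<inter> S = {}"
proof -
  have "finite (S \<inter> {t - 1..t + 1})" by (rule assms)
  then obtain d where d: "d > 0" "\<forall>x\<in>S \<inter> {t - 1..t + 1}. x \<noteq> t \<longrightarrow> d \<le> dist t x"
    by (metis finite_set_avoid)
  have "ball t (min d 1) \<inter> S = {}"
  proof (intro equalityI subsetI)
    fix x assume x: "x \<in> ball t (min d 1) \<inter> S"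
    then have "x \<in> S \<inter> {t - 1..t + 1}" by (auto simp: dist_real_def)
    moreover have "x \<noteq> t" "dist t x < d" using x assms(2) by auto
    ultimately show "x \<in> {}" using d(2) by force
  qed simp
  with d(1) that[of "min d 1"] show thesis by simp
qed

lemma switching_times_locally_constant:
  assumes "switching_times u S" "t \<notin> S"
  obtains e where "e > 0" "\<And>s. s \<in> ball t e \<Longrightarrow> u s = u t"
proof -
  obtain e where e: "e > 0" "ball t e \<inter> S = {}"
    using locally_finite_avoid[of S t] assms unfolding switching_times_def by metis
  then have "u constant_on ball t e"
    using assms unfolding switching_times_def by simp
  then obtain c where c: "\<And>s. s \<in> ball t e \<Longrightarrow> u s = c"
    unfolding constant_on_def by blast
  with e(1) have "u t = c" by simp
  with e(1) that c show thesis by metis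
qed

text \<open>
  Hence a solution has to satisfy the differential equation at all times outside a locally finite
  set, which is the form in which solutions are shifted, glued and compared below.
\<close>
lemma switching_times_isCont:
  assumes "switching_times u S" "t \<notin> S"
  shows "isCont u t"
proof -
  obtain e where e: "e > 0" "\<And>s. s \<in> ball t e \<Longrightarrow> u s = u t"
    using switching_times_locally_constant[OF assms] by metis
  then have "\<forall>\<^sub>F s in nhds t. u s = u t"
    unfolding eventually_nhds by (metis centre_in_ball open_ball)
  then show ?thesis
    using isCont_cong[of u "\<lambda>_. u t" t] by simp
qed

lemma admissible_const: "c \<in> \<Omega> \<Longrightarrow> (\<lambda>_. c) \<in> admissible \<Omega>"
proof -
  assume "c \<in> \<Omega>"
  moreover have "switching_times (\<lambda>_. c) {}"
    unfolding switching_times_def constant_on_def by blast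
  ultimately show ?thesis unfolding admissible_def piecewise_constant_iff by blast
qed

lemma locally_finite_shift:
  fixes S :: "real set"
  assumes "\<And>a b. finite (S \<inter> {a..b})"
  shows "finite ({s. t + s \<in> S} \<inter> {a..b})"
proof -
  have "{s. t + s \<in> S} \<inter> {a..b} = (\<lambda>s. s - t) ` (S \<inter> {t + a..t + b})"
    by (auto simp: image_iff intro!: bexI[of _ "t + _"])
  then show ?thesis using assms by simp
qed

lemma switching_times_shift:
  assumes "switching_times u S"
  shows "switching_times (\<lambda>s. u (t + s)) {s. t + s \<in> S}"
  unfolding switching_times_def
proof (intro conjI allI impI)
  fix I assume I: "connected I \<and> I \<inter> {s. t + s \<in> S} = {}"
  then have "connected ((+) t ` I)" "(+) t ` I \<inter> S = {}"
    by (auto intro!: connected_continuous_image continuous_intros)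
  with assms have "u constant_on (+) t ` I" unfolding switching_times_def by blast
  then show "(\<lambda>s. u (t + s)) constant_on I" unfolding constant_on_def by auto
qed (use assms locally_finite_shift in \<open>auto simp: switching_times_def\<close>)

lemma admissible_shift:
  assumes "u \<in> admissible \<Omega>"
  shows "(\<lambda>s. u (t + s)) \<in> admissible \<Omega>"
  using assms switching_times_shift unfolding admissible_def piecewise_constant_iff by blast

text \<open>
  Only the value at the switching time itself is a matter of convention; the second control starts
  with its own clock.
\<close>
definition switch_at :: "real \<Rightarrow> (real \<Rightarrow> 'b) \<Rightarrow> (real \<Rightarrow> 'b) \<Rightarrow> real \<Rightarrow> 'b" where
  "switch_at t u w s = (if s < t then u s else w (s - t))"

text \<open>
  A connected set of times that avoids \<open>t\<close> lies on one side of \<open>t\<close>, where only one of the two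
  controls is in force.
\<close>
lemma switching_times_switch_at:
  assumes "switching_times u S" "switching_times w T"
  shows "switching_times (switch_at t u w) ({t} \<union> S \<union> {s. - t + s \<in> T})"
  unfolding switching_times_def
proof (intro conjI allI impI)
  fix a b
  show "finite (({t} \<union> S \<union> {s. - t + s \<in> T}) \<inter> {a..b})"
    using assms locally_finite_shift[of T "- t" a b]
    by (simp add: switching_times_def Int_Un_distrib2 Int_insert_left)
next
  fix I assume I: "connected I \<and> I \<inter> ({t} \<union> S \<union> {s. - t + s \<in> T}) = {}"
  have "t \<notin> I" using I by auto
  then consider "\<forall>s\<in>I. s < t" | "\<forall>s\<in>I. s > t"
  proof -
    have "x \<ge> t \<or> y \<le> t" if "x \<in> I" "y \<in> I" for x y
      using connectedD_interval[of I x y t] I that \<open>t \<notin> I\<close> by auto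
    moreover have "x \<noteq> t" if "x \<in> I" for x using that \<open>t \<notin> I\<close> by auto
    ultimately have "(\<forall>s\<in>I. s < t) \<or> (\<forall>s\<in>I. s > t)"
      by (meson linorder_neqE_linordered_idom not_le order_less_le)
    then show thesis using that by blast
  qed
  then show "switch_at t u w constant_on I"
  proof cases
    case 1
    have "u constant_on I" using I assms(1) unfolding switching_times_def by blast
    with 1 show ?thesis by (auto simp: constant_on_def switch_at_def)
  next
    case 2
    have "(\<lambda>s. w (- t + s)) constant_on I"
      using I switching_times_shift[OF assms(2), of "- t"] unfolding switching_times_def by blast
    then obtain c where "\<And>s. s \<in> I \<Longrightarrow> w (- t + s) = c" by (auto simp: constant_on_def)
    with 2 show ?thesis by (force simp: constant_on_def switch_at_def)
  qed
qed

lemma admissible_switch_at: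
  assumes "u \<in> admissible \<Omega>" "w \<in> admissible \<Omega>"
  shows "switch_at t u w \<in> admissible \<Omega>"
proof -
  have "piecewise_constant (switch_at t u w)"
    using assms switching_times_switch_at unfolding admissible_def piecewise_constant_iff by blast
  moreover have "range (switch_at t u w) \<subseteq> \<Omega>"
    using assms by (auto simp: admissible_def switch_at_def)
  ultimately show ?thesis by (simp add: admissible_def)
qed

text \<open>
  Integrating from \<open>0\<close> needs a case distinction on the sign of the end point. Near a given time the
  primitive is the integral from a fixed starting point to the left of \<open>0\<close>, up to a constant, which
  reduces continuity and differentiability to indefinite integrals over a fixed interval.
\<close>
lemma primitive_of_locally_integrable:
  fixes g :: "real \<Rightarrow> 'a::banach"
  assumes int: "\<And>a b. g integrable_on {a..b}"
  obtains F where "continuous_on UNIV F" "F 0 = 0"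
    "\<And>t. isCont g t \<Longrightarrow> (F has_vector_derivative g t) (at t)"
    "\<And>t. t \<ge> 0 \<Longrightarrow> F t = integral {0..t} g"
proof -
  define F :: "real \<Rightarrow> 'a" where "F = (\<lambda>t. integral {0..t} g - integral {t..0} g)"
  have F: "F s = integral {a..s} g - integral {a..0} g" if "a \<le> 0" "a \<le> s" for a s
  proof (cases "s \<ge> 0")
    case True
    then have "integral {s..0} g = 0" by (cases "s = 0") auto
    then show ?thesis unfolding F_def
      using Henstock_Kurzweil_Integration.integral_combine[of a 0 s g] that True int by (auto simp: algebra_simps)
  next
    case False
    then have "integral {0..s} g = 0" by auto
    then show ?thesis unfolding F_def
      using Henstock_Kurzweil_Integration.integral_combine[of a s 0 g] that False int by (auto simp: algebra_simps)
  qed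
  have near: "\<forall>\<^sub>F s in nhds t. F s = integral {min 0 t - 1..s} g - integral {min 0 t - 1..0} g" for t
    by (rule eventually_nhds_in_open[of "{min 0 t - 1<..}", THEN eventually_mono])
      (auto intro!: F)
  have "isCont F t" for t
  proof -
    have "continuous_on {min 0 t - 1..t + 1} (\<lambda>s. integral {min 0 t - 1..s} g)"
      by (intro indefinite_integral_continuous_1 int)
    then have "isCont (\<lambda>s. integral {min 0 t - 1..s} g) t"
      by (intro continuous_on_interior) auto
    then have "isCont (\<lambda>s. integral {min 0 t - 1..s} g - integral {min 0 t - 1..0} g) t"
      by (intro continuous_intros)
    then show ?thesis using isCont_cong[OF near[of t]] by simp
  qed
  moreover have "(F has_vector_derivative g t) (at t)" if "isCont g t" for t
  proof -
    have "((\<lambda>s. integral {min 0 t - 1..s} g) has_vector_derivative g t)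
      (at t within ({min 0 t - 1..t + 1} - {}))"
      by (rule integral_has_vector_derivative_continuous_at)
        (use that int in \<open>auto intro: continuous_at_imp_continuous_at_within\<close>)
    moreover have "at t within ({min 0 t - 1..t + 1} - {}) = at t"
      by (rule at_within_interior) auto
    ultimately have "((\<lambda>s. integral {min 0 t - 1..s} g - integral {min 0 t - 1..0} g)
      has_vector_derivative g t) (at t)"
      by (auto simp: has_vector_derivative_diff_const)
    moreover have "F t = integral {min 0 t - 1..t} g - integral {min 0 t - 1..0} g"
      by (rule F) auto
    ultimately show ?thesis
      unfolding has_vector_derivative_def
      using near[of t] by (auto simp: eventually_nhds_conv_at elim!: has_derivative_transform_eventually
         intro: eventually_mono)
  qed
  moreover have "F 0 = 0" "\<And>t. t \<ge> 0 \<Longrightarrow> F t = integral {0..t} g"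
    using F[of 0] by auto
  ultimately show thesis
    using that[of F] by (auto simp: continuous_on_eq_continuous_at)
qed

lemma integrable_continuous_off_countable:
  fixes g :: "real \<Rightarrow> 'a::euclidean_space"
  assumes "countable S" "\<And>t. t \<notin> S \<Longrightarrow> isCont g t"
    and "\<And>t. t \<in> {a..b} \<Longrightarrow> norm (g t) \<le> B"
  shows "g integrable_on {a..b}"
proof (rule measurable_bounded_by_integrable_imp_integrable[where g = "\<lambda>_. B"])
  have "g \<in> borel_measurable borel"
    using assms by (intro borel_measurable_continuous_countable_exceptions[of S])
      (auto intro!: continuous_at_imp_continuous_on)
  then show "g \<in> borel_measurable (lebesgue_on {a..b})"
    by (intro measurable_restrict_space1 measurable_completion) simp
qed (use assms in auto)

lemma constant_if_derivative_zero_off_locally_finite: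
  fixes g :: "real \<Rightarrow> 'a::banach"
  assumes "\<And>a b. finite (S \<inter> {a..b})" "continuous_on UNIV g"
    and "\<And>t. t \<notin> S \<Longrightarrow> (g has_vector_derivative 0) (at t)"
  shows "g t = g 0"
proof (rule has_derivative_zero_unique_strong_convex[where S = "{- \<bar>t\<bar>..\<bar>t\<bar>}" and K = "S \<inter> {- \<bar>t\<bar>..\<bar>t\<bar>}"])
  fix x assume "x \<in> {- \<bar>t\<bar>..\<bar>t\<bar>} - S \<inter> {- \<bar>t\<bar>..\<bar>t\<bar>}"
  then have "(g has_vector_derivative 0) (at x)" using assms by auto
  then show "(g has_derivative (\<lambda>h. 0)) (at x within {- \<bar>t\<bar>..\<bar>t\<bar>})"
    by (auto simp: has_vector_derivative_def intro: has_derivative_at_withinI)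
qed (use assms in \<open>auto intro: continuous_on_subset\<close>)

section \<open>Solutions in complex notation\<close>

text \<open>
  The planar system after identifying \<open>\<real>\<^sup>2\<close> with \<open>\<complex>\<close>: the matrix \<open>A - u \<theta>\<close> commutes with rotations and
  becomes multiplication by a complex number.
\<close>
definition rotor_rhs :: "real \<Rightarrow> real \<Rightarrow> complex \<Rightarrow> complex \<Rightarrow> real \<Rightarrow> complex" where
  "rotor_rhs lam mu \<eta> v u = Complex lam (mu - u) * v + of_real u * \<eta>"

text \<open>
  Variation of constants: \<open>E\<close> solves the homogeneous equation and \<open>K\<close> is the primitive of
  \<open>u \<eta> / E\<close>. The control enters the exponent of \<open>E\<close> only through its imaginary part, so the modulus of
  \<open>E\<close> does not depend on it; the bound on the inhomogeneous part integrates that modulus.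
\<close>
lemma solution_formula:
  fixes \<eta> :: complex
  assumes "u \<in> admissible {um..up}"
  obtains E K :: "real \<Rightarrow> complex"
  where "\<And>x. is_solution (rotor_rhs lam mu \<eta>) x u (\<lambda>t. E t * (x + K t))"
    and "continuous_on UNIV E"
    and "\<And>t. isCont u t \<Longrightarrow> (E has_vector_derivative Complex lam (mu - u t) * E t) (at t)"
    and "\<And>t. norm (E t) = exp (lam * t)"
    and "\<And>t. lam \<noteq> 0 \<Longrightarrow> t \<ge> 0 \<Longrightarrow>
          norm (E t * K t) \<le> max \<bar>um\<bar> \<bar>up\<bar> * norm \<eta> * ((exp (lam * t) - 1) / lam)"
proof -
  from assms obtain S where S: "switching_times u S" and ran: "\<And>t. u t \<in> {um..up}"
    unfolding admissible_def piecewise_constant_iff by blast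
  have cS: "countable S"
    using S by (intro locally_finite_imp_countable) (auto simp: switching_times_def)
  note cont = switching_times_isCont[OF S]
  define B where "B = max \<bar>um\<bar> \<bar>up\<bar>"
  have B: "\<bar>u t\<bar> \<le> B" for t
    using ran[of t] unfolding B_def by auto
  have "u integrable_on {a..b}" for a b
    by (rule integrable_continuous_off_countable[OF cS cont, where B = B]) (use B in auto)
  then obtain U where U: "continuous_on UNIV U" "U 0 = 0"
    "\<And>t. isCont u t \<Longrightarrow> (U has_vector_derivative u t) (at t)"
    using primitive_of_locally_integrable[of u] by metis
  define E where "E t = exp (Complex (lam * t) (mu * t - U t))" for t
  have Enz: "E t \<noteq> 0" for t by (simp add: E_def)
  have normE: "norm (E t) = exp (lam * t)" for t by (simp add: E_def norm_exp_eq_Re)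
  have contE: "continuous_on UNIV E"
    unfolding E_def Complex_eq using U(1) by (intro continuous_intros)
  have derE: "(E has_vector_derivative Complex lam (mu - u t) * E t) (at t)" if "isCont u t" for t
  proof -
    have "((\<lambda>t. of_real (lam * t) + \<i> * of_real (mu * t - U t)) has_vector_derivative
        of_real lam + \<i> * of_real (mu - u t)) (at t)"
      by (rule derivative_eq_intros U(3)[OF that, folded has_real_derivative_iff_has_vector_derivative] refl
          | simp)+
    then have "((\<lambda>t. Complex (lam * t) (mu * t - U t)) has_vector_derivative Complex lam (mu - u t)) (at t)"
      by (simp only: Complex_eq)
    from field_vector_diff_chain_at[OF this DERIV_exp]
    show ?thesis by (simp add: E_def[abs_def] o_def)
  qed
  define g where "g t = of_real (u t) * \<eta> / E t" for t
  have contg: "isCont g t" if "isCont u t" for t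
    unfolding g_def using that contE Enz
    by (intro continuous_intros) (auto simp: continuous_on_eq_continuous_at)
  have normg: "norm (g t) \<le> B * norm \<eta> * exp (- lam * t)" for t
  proof -
    have "norm (g t) = \<bar>u t\<bar> * norm \<eta> * exp (- lam * t)"
      by (simp add: g_def norm_mult norm_divide normE exp_minus field_simps)
    also have "\<dots> \<le> B * norm \<eta> * exp (- lam * t)"
      by (intro mult_right_mono B) auto
    finally show ?thesis .
  qed
  have intg: "g integrable_on {a..b}" for a b
  proof (rule integrable_continuous_off_countable[OF cS contg[OF cont]])
    fix t assume "t \<in> {a..b}"
    have "- lam * t \<le> \<bar>lam\<bar> * (\<bar>a\<bar> + \<bar>b\<bar>)"
    proof -
      have "- lam * t \<le> \<bar>lam\<bar> * \<bar>t\<bar>" by (metis abs_ge_self abs_minus_cancel abs_mult)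
      also have "\<dots> \<le> \<bar>lam\<bar> * (\<bar>a\<bar> + \<bar>b\<bar>)"
        using \<open>t \<in> {a..b}\<close> by (intro mult_left_mono) auto
      finally show ?thesis .
    qed
    moreover have "B \<ge> 0" by (simp add: B_def)
    ultimately show "norm (g t) \<le> B * norm \<eta> * exp (\<bar>lam\<bar> * (\<bar>a\<bar> + \<bar>b\<bar>))"
      by (intro order_trans[OF normg] mult_left_mono) auto
  qed
  obtain K where K: "continuous_on UNIV K" "K 0 = 0"
    "\<And>t. isCont g t \<Longrightarrow> (K has_vector_derivative g t) (at t)"
    "\<And>t. t \<ge> 0 \<Longrightarrow> K t = integral {0..t} g"
    using primitive_of_locally_integrable[of g] intg by metis
  have "is_solution (rotor_rhs lam mu \<eta>) x u (\<lambda>t. E t * (x + K t))" for x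
    unfolding is_solution_def
  proof (intro conjI allI impI)
    show "continuous_on UNIV (\<lambda>t. E t * (x + K t))"
      using K(1) contE by (intro continuous_intros)
    show "E 0 * (x + K 0) = x" by (simp add: E_def U(2) K(2) Complex_eq)
    fix t assume t: "isCont u t"
    have "((\<lambda>t. E t * (x + K t)) has_vector_derivative
        E t * (0 + g t) + Complex lam (mu - u t) * E t * (x + K t)) (at t)"
      by (intro has_vector_derivative_mult has_vector_derivative_add has_vector_derivative_const
          derE t K(3) contg)
    moreover have "E t * (0 + g t) + Complex lam (mu - u t) * E t * (x + K t)
        = rotor_rhs lam mu \<eta> (E t * (x + K t)) (u t)"
      using Enz[of t] by (simp add: rotor_rhs_def g_def)
    ultimately show "((\<lambda>t. E t * (x + K t)) has_vector_derivative
        rotor_rhs lam mu \<eta> (E t * (x + K t)) (u t)) (at t)" by simp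
  qed
  moreover have "norm (E t * K t) \<le> B * norm \<eta> * ((exp (lam * t) - 1) / lam)"
    if "lam \<noteq> 0" "t \<ge> 0" for t
  proof -
    define G where "G s = B * norm \<eta> * (- exp (- lam * s) / lam)" for s
    have "((\<lambda>s. B * norm \<eta> * exp (- lam * s)) has_integral G t - G 0) {0..t}"
      unfolding G_def
      by (rule fundamental_theorem_of_calculus[OF that(2)])
        (auto intro!: derivative_eq_intros simp: has_real_derivative_iff_has_vector_derivative[symmetric] that)
    then have "norm (integral {0..t} g) \<le> G t - G 0"
      using integral_norm_bound_integral[of g "{0..t}" "\<lambda>s. B * norm \<eta> * exp (- lam * s)"]
        intg normg by (metis has_integral_integrable integral_unique)
    then have "norm (E t * K t) \<le> exp (lam * t) * (G t - G 0)"
      by (simp add: K(4)[OF that(2)] norm_mult normE)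
    also have "\<dots> = B * norm \<eta> * ((exp (lam * t) - 1) / lam)"
      using that(1) by (simp add: G_def exp_minus field_simps)
    finally show ?thesis .
  qed
  ultimately show thesis using that[of E K] normE contE derE unfolding B_def by blast
qed

text \<open>
  The difference of two solutions, divided by the homogeneous solution \<open>E\<close>, has derivative zero
  outside a locally finite set. One of the two candidates need only satisfy the equation off
  an arbitrary locally finite set, so that glued trajectories qualify without any care about the
  values of the control at the switching times.
\<close>
lemma solution_unique:
  fixes x :: complex
  assumes u: "u \<in> admissible {um..up}" and S: "\<And>a b. finite (S \<inter> {a..b})"
    and g: "continuous_on UNIV \<gamma>" "\<gamma> 0 = x"
      "\<And>t. t \<notin> S \<Longrightarrow> (\<gamma> has_vector_derivative rotor_rhs lam mu \<eta> (\<gamma> t) (u t)) (at t)"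
    and sol: "is_solution (rotor_rhs lam mu \<eta>) x u \<delta>"
  shows "\<gamma> = \<delta>"
proof -
  from u obtain T where T: "switching_times u T"
    unfolding admissible_def piecewise_constant_iff by auto
  obtain E where contE: "continuous_on UNIV E"
    and derE: "\<And>t. isCont u t \<Longrightarrow> (E has_vector_derivative Complex lam (mu - u t) * E t) (at t)"
    and normE: "\<And>t. norm (E t) = exp (lam * t)"
    using solution_formula[OF u] by metis
  have Enz: "E t \<noteq> 0" for t using normE[of t] by (metis exp_not_eq_zero norm_zero)
  define q where "q t = (\<gamma> t - \<delta> t) / E t" for t
  have "q t = q 0" for t
  proof (rule constant_if_derivative_zero_off_locally_finite[of "S \<union> T"])
    show "finite ((S \<union> T) \<inter> {a..b})" for a b
      using S T by (simp add: Int_Un_distrib2 switching_times_def)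
    show "continuous_on UNIV q"
      unfolding q_def using g(1) sol contE Enz
      by (intro continuous_intros) (auto simp: is_solution_def)
    fix t assume t: "t \<notin> S \<union> T"
    then have ct: "isCont u t" using switching_times_isCont[OF T] by auto
    define d where "d = Complex lam (mu - u t)"
    have "((\<lambda>t. \<gamma> t - \<delta> t) has_vector_derivative
        rotor_rhs lam mu \<eta> (\<gamma> t) (u t) - rotor_rhs lam mu \<eta> (\<delta> t) (u t)) (at t)"
      using g(3)[of t] sol t ct unfolding is_solution_def by (intro has_vector_derivative_diff) auto
    then have "((\<lambda>t. \<gamma> t - \<delta> t) has_vector_derivative d * (\<gamma> t - \<delta> t)) (at t)"
      by (simp add: rotor_rhs_def algebra_simps d_def)
    moreover have "((\<lambda>t. inverse (E t)) has_vector_derivative (d * E t) * (- (inverse (E t) ^ Suc (Suc 0)))) (at t)"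
      using field_vector_diff_chain_at[OF derE[OF ct] DERIV_inverse[OF Enz[of t]]]
      by (simp add: o_def d_def)
    ultimately have "((\<lambda>t. (\<gamma> t - \<delta> t) * inverse (E t)) has_vector_derivative
      (\<gamma> t - \<delta> t) * ((d * E t) * (- (inverse (E t) ^ Suc (Suc 0)))) + d * (\<gamma> t - \<delta> t) * inverse (E t)) (at t)"
      by (rule has_vector_derivative_mult)
    moreover have "(\<gamma> t - \<delta> t) * ((d * E t) * (- (inverse (E t) ^ Suc (Suc 0)))) + d * (\<gamma> t - \<delta> t) * inverse (E t) = 0"
      using Enz[of t] by (simp add: field_simps)
    ultimately show "(q has_vector_derivative 0) (at t)"
      by (simp only: q_def[abs_def] divide_inverse)
  qed
  moreover have "q 0 = 0" using g(2) sol by (simp add: q_def is_solution_def)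
  ultimately have "\<gamma> t = \<delta> t" for t
    using Enz[of t] by (metis q_def divide_eq_0_iff eq_iff_diff_eq_0)
  then show ?thesis by blast
qed

lemma ex1_solution:
  fixes x :: complex
  assumes "u \<in> admissible {um..up}"
  shows "\<exists>!\<gamma>. is_solution (rotor_rhs lam mu \<eta>) x u \<gamma>"
proof -
  obtain S where "switching_times u S"
    using assms unfolding admissible_def piecewise_constant_iff by auto
  then have S: "\<And>a b. finite (S \<inter> {a..b})" "\<And>t. t \<notin> S \<Longrightarrow> isCont u t"
    using switching_times_isCont by (auto simp: switching_times_def)
  obtain E K where EK: "is_solution (rotor_rhs lam mu \<eta>) x u (\<lambda>t. E t * (x + K t))"
    using solution_formula[OF assms] by metis
  show ?thesis
  proof (intro ex1I[of _ "\<lambda>t. E t * (x + K t)"] EK)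
    fix \<gamma> assume "is_solution (rotor_rhs lam mu \<eta>) x u \<gamma>"
    then show "\<gamma> = (\<lambda>t. E t * (x + K t))"
      by (intro solution_unique[OF assms S(1) _ _ _ EK]) (auto simp: is_solution_def S(2))
  qed
qed

lemma flow_is_solution:
  fixes x :: complex
  assumes "u \<in> admissible {um..up}"
  shows "is_solution (rotor_rhs lam mu \<eta>) x u (\<lambda>t. flow (rotor_rhs lam mu \<eta>) t x u)"
  using theI'[OF ex1_solution[OF assms]] unfolding flow_def .

text \<open>
  The rule by which all formulas for the flow are obtained.
\<close>
lemma flow_eqI:
  fixes x :: complex
  assumes "u \<in> admissible {um..up}" and "\<And>a b. finite (S \<inter> {a..b})"
    and "continuous_on UNIV \<gamma>" "\<gamma> 0 = x"
    and "\<And>t. t \<notin> S \<Longrightarrow> (\<gamma> has_vector_derivative rotor_rhs lam mu \<eta> (\<gamma> t) (u t)) (at t)"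
  shows "flow (rotor_rhs lam mu \<eta>) t x u = \<gamma> t"
  using solution_unique[OF assms flow_is_solution[OF assms(1)]] by simp

section \<open>A spiral meets an arc\<close>

text \<open>
  Used for projecting the plane along the direction \<open>c\<close>.
\<close>
lemma real_line_iff_Im_cnj_zero:
  fixes c z :: complex
  assumes "c \<noteq> 0"
  shows "Im (z * cnj c) = 0 \<longleftrightarrow> (\<exists>s::real. z = of_real s * c)"
proof
  assume z: "Im (z * cnj c) = 0"
  have "z = (z * cnj c) / (c * cnj c) * c" using assms by simp
  also have "z * cnj c = of_real (Re (z * cnj c))" using z by (simp add: complex_eq_iff)
  also have "c * cnj c = of_real ((cmod c)\<^sup>2)" by (rule complex_norm_square[symmetric])
  finally show "\<exists>s::real. z = of_real s * c" by (metis of_real_divide)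
qed (auto simp: complex_mult_cnj mult.assoc)

lemma progression_meets_interval:
  fixes a b d y :: real
  assumes "d \<noteq> 0" "b - a \<ge> \<bar>d\<bar>"
  obtains k :: int where "y + of_int k * d \<in> {a..b}"
proof -
  define k where "k = \<lceil>(a - y) / \<bar>d\<bar>\<rceil>"
  have "of_int k \<ge> (a - y) / \<bar>d\<bar>" "of_int k < (a - y) / \<bar>d\<bar> + 1"
    unfolding k_def by linarith+
  then have "y + of_int k * \<bar>d\<bar> \<ge> a" "y + of_int k * \<bar>d\<bar> \<le> b"
    using assms by (auto simp: field_simps)
  moreover have "of_int k * \<bar>d\<bar> = of_int (if d > 0 then k else - k) * d"
    using assms by auto
  ultimately show thesis using that by (metis atLeastAtMost_iff)
qed

text \<open>
  Take logarithms. The arc \<open>t \<mapsto> q (1 - exp (c\<^sub>1 t))\<close> becomes a curve \<open>L\<close> whose real part tends to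
  \<open>-\<infinity>\<close> as \<open>t\<close> tends to \<open>0\<close> while its imaginary part stays bounded. The spirals \<open>exp (c\<^sub>0 s) w\<close> become lines
  in the direction \<open>c\<^sub>0\<close>, and \<open>p\<close>, the imaginary part of multiplication by the conjugate of \<open>c\<^sub>0\<close>,
  tells these lines apart. As \<open>Im c\<^sub>0 \<noteq> 0\<close>, \<open>p\<close> is unbounded along \<open>L\<close>. The logarithm of a point \<open>z\<close>
  is determined up to \<open>2 \<pi> \<i>\<close>, which changes \<open>p\<close> by \<open>2 \<pi> Re c\<^sub>0 \<noteq> 0\<close>; so any piece of the arc on
  which \<open>p\<close> varies by this amount meets the spirals through all points. That the piece stays away
  from \<open>t = 0\<close>, uniformly in \<open>z\<close>, is what later gives a ball of positive radius.
\<close>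
lemma spiral_meets_arc:
  fixes c\<^sub>0 c\<^sub>1 q :: complex and T :: real
  assumes c0: "Re c\<^sub>0 \<noteq> 0" "Im c\<^sub>0 \<noteq> 0" and c1: "c\<^sub>1 \<noteq> 0" and q: "q \<noteq> 0" and T: "T > 0"
  obtains t\<^sub>1 where "0 < t\<^sub>1" "t\<^sub>1 \<le> T"
    "\<And>z. z \<noteq> 0 \<Longrightarrow> \<exists>t\<in>{t\<^sub>1..T}. \<exists>s::real. z = exp (c\<^sub>0 * s) * (q * (1 - exp (c\<^sub>1 * t)))"
proof -
  \<comment> \<open>Near \<open>t = 0\<close> the arc is \<open>- q c\<^sub>1 t h(t)\<close> with \<open>h(t)\<close> close to \<open>1\<close>, so the principal branch
      gives a continuous logarithm of it.\<close>
  define h where "h t = (exp (c\<^sub>1 * of_real t) - 1) / (c\<^sub>1 * of_real t)" for t :: real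
  have "filterlim (\<lambda>t. c\<^sub>1 * of_real t) (at 0) (at_right 0)"
  proof (rule filterlim_atI)
    show "((\<lambda>t. c\<^sub>1 * of_real t) \<longlongrightarrow> 0) (at_right 0)"
      by (rule tendsto_eq_intros refl | simp)+
    show "\<forall>\<^sub>F t in at_right 0. c\<^sub>1 * complex_of_real t \<noteq> 0"
      using c1 by (auto simp: eventually_at_right_less intro: eventually_mono[OF eventually_at_right_less[of 0]])
  qed
  then have h1: "(h \<longlongrightarrow> 1) (at_right 0)"
    unfolding h_def by (rule filterlim_compose[OF lim_exp_minus_1])
  then have "\<forall>\<^sub>F t in at_right 0. dist (h t) 1 < 1"
    by (rule tendstoD) simp
  then obtain T' where T': "T' > 0" "\<And>t. 0 < t \<Longrightarrow> t < T' \<Longrightarrow> dist (h t) 1 < 1"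
    unfolding eventually_at_right_field by auto
  define T0 where "T0 = min T (T' / 2)"
  have T0: "0 < T0" "T0 \<le> T" using T T' by (auto simp: T0_def)
  have Reh: "h t \<notin> \<real>\<^sub>\<le>\<^sub>0" if "t \<in> {0<..T0}" for t
  proof -
    have "dist (h t) 1 < 1" using that T' by (intro T'(2)) (auto simp: T0_def)
    then have "\<bar>Re (h t - 1)\<bar> < 1" by (metis abs_Re_le_cmod dist_norm le_less_trans)
    then show ?thesis by (auto simp: complex_nonpos_Reals_iff)
  qed
  then have hnz: "h t \<noteq> 0" if "t \<in> {0<..T0}" for t using that by force
  define L where "L t = of_real (ln t) + Ln (h t) + Ln (- q * c\<^sub>1)" for t
  have expL: "exp (L t) = q * (1 - exp (c\<^sub>1 * t))" if "t \<in> {0<..T0}" for t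
  proof -
    have "exp (L t) = of_real t * h t * (- q * c\<^sub>1)"
      using that hnz[OF that] q c1 by (simp add: L_def exp_add exp_of_real)
    also have "\<dots> = q * (1 - exp (c\<^sub>1 * t))"
      using that c1 by (simp add: h_def field_simps)
    finally show ?thesis .
  qed
  define p where "p t = Im (L t * cnj c\<^sub>0)" for t
  have "continuous_on {0<..T0} h"
    unfolding h_def using c1 by (intro continuous_intros) auto
  then have "continuous_on {0<..T0} L"
    unfolding L_def using Reh by (intro continuous_intros continuous_on_ln) auto
  then have contp: "continuous_on {0<..T0} p"
    unfolding p_def by (intro continuous_intros)
  \<comment> \<open>Up to a convergent term, \<open>p t\<close> is \<open>- Im c\<^sub>0 ln t\<close>.\<close>
  define C where "C = Im (Ln (- q * c\<^sub>1) * cnj c\<^sub>0)"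
  have "((\<lambda>t. Im ((Ln (h t) + Ln (- q * c\<^sub>1)) * cnj c\<^sub>0)) \<longlongrightarrow> Im ((Ln 1 + Ln (- q * c\<^sub>1)) * cnj c\<^sub>0)) (at_right 0)"
    by (intro tendsto_intros h1) auto
  then have "((\<lambda>t. Im ((Ln (h t) + Ln (- q * c\<^sub>1)) * cnj c\<^sub>0)) \<longlongrightarrow> C) (at_right 0)"
    by (simp add: C_def)
  moreover have "Im ((Ln (h t) + Ln (- q * c\<^sub>1)) * cnj c\<^sub>0) = p t + Im c\<^sub>0 * ln t" for t
    by (simp add: p_def L_def algebra_simps)
  ultimately have "((\<lambda>t. p t + Im c\<^sub>0 * ln t) \<longlongrightarrow> C) (at_right 0)" by simp
  then have ev1: "\<forall>\<^sub>F t in at_right 0. dist (p t + Im c\<^sub>0 * ln t) C < 1"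
    by (rule tendstoD) simp
  have ev2: "\<forall>\<^sub>F t in at_right 0. ln t \<le> - ((2 * pi * \<bar>Re c\<^sub>0\<bar> + \<bar>p T0\<bar> + \<bar>C\<bar> + 1) / \<bar>Im c\<^sub>0\<bar>)"
    using ln_at_0 unfolding filterlim_at_bot by blast
  have ev3: "\<forall>\<^sub>F t in at_right 0. t \<in> {0<..<T0}"
    using eventually_at_right_real[OF T0(1)] .
  from eventually_happens'[OF trivial_limit_at_right_real eventually_conj[OF ev1 eventually_conj[OF ev2 ev3]]]
  obtain t1 where t1: "dist (p t1 + Im c\<^sub>0 * ln t1) C < 1" "t1 \<in> {0<..<T0}"
    "ln t1 \<le> - ((2 * pi * \<bar>Re c\<^sub>0\<bar> + \<bar>p T0\<bar> + \<bar>C\<bar> + 1) / \<bar>Im c\<^sub>0\<bar>)" by auto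
  have "\<bar>p t1 - p T0\<bar> \<ge> 2 * pi * \<bar>Re c\<^sub>0\<bar>"
  proof -
    have "\<bar>Im c\<^sub>0 * ln t1\<bar> = \<bar>Im c\<^sub>0\<bar> * \<bar>ln t1\<bar>" by (rule abs_mult)
    moreover have "\<bar>Im c\<^sub>0\<bar> * (- ln t1) \<ge> 2 * pi * \<bar>Re c\<^sub>0\<bar> + \<bar>p T0\<bar> + \<bar>C\<bar> + 1"
      using t1(3) c0(2) by (simp add: field_simps)
    moreover have "\<bar>Im c\<^sub>0\<bar> * (- ln t1) \<le> \<bar>Im c\<^sub>0\<bar> * \<bar>ln t1\<bar>"
      by (intro mult_left_mono) auto
    ultimately show ?thesis using t1(1) by (simp only: dist_real_def) linarith
  qed
  then have wide: "max (p t1) (p T0) - min (p t1) (p T0) \<ge> \<bar>2 * pi * Re c\<^sub>0\<bar>"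
    by (simp add: abs_mult)
  have ivt: "\<exists>t\<in>{t1..T0}. p t = y" if "y \<in> {min (p t1) (p T0)..max (p t1) (p T0)}" for y
  proof -
    have cp: "continuous_on {t1..T0} p"
      using t1(2) by (intro continuous_on_subset[OF contp]) auto
    show ?thesis
      using IVT'[of p t1 y T0] IVT2'[of p T0 y t1] cp that t1(2) by (cases "p t1 \<le> p T0") fastforce+
  qed
  show thesis
  proof
    show "0 < t1" "t1 \<le> T" using t1(2) T0 by auto
    fix z :: complex assume z: "z \<noteq> 0"
    obtain k :: int where
      k: "Im (Ln z * cnj c\<^sub>0) + of_int k * (2 * pi * Re c\<^sub>0) \<in> {min (p t1) (p T0)..max (p t1) (p T0)}"
      by (rule progression_meets_interval[OF _ wide, of "Im (Ln z * cnj c\<^sub>0)"]) (use c0 in auto)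
    then obtain t where t: "t \<in> {t1..T0}" "p t = Im (Ln z * cnj c\<^sub>0) + of_int k * (2 * pi * Re c\<^sub>0)"
      using ivt by blast
    have "Im ((L t - (Ln z + of_int k * (of_real (2 * pi) * \<i>))) * cnj c\<^sub>0) = 0"
      using t(2) by (simp add: p_def algebra_simps)
    then obtain s :: real where s: "L t - (Ln z + of_int k * (of_real (2 * pi) * \<i>)) = of_real s * c\<^sub>0"
      using real_line_iff_Im_cnj_zero[of c\<^sub>0] c0 by (metis zero_complex.simps(1))
    then have "L t = Ln z + of_int k * (of_real (2 * pi) * \<i>) + of_real s * c\<^sub>0" by (simp add: algebra_simps)
    then have "exp (L t) = z * exp (of_real s * c\<^sub>0)"
      using z exp_integer_2pi[of "of_int k"] by (simp add: exp_add mult_ac)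
    then have "z = exp (c\<^sub>0 * of_real (- s)) * exp (L t)"
      by (simp add: exp_minus field_simps)
    then show "\<exists>t\<in>{t1..T}. \<exists>s::real. z = exp (c\<^sub>0 * s) * (q * (1 - exp (c\<^sub>1 * t)))"
      using expL[of t] t(1) t1(2) T0 by (intro bexI[of _ t] exI[of _ "- s"]) auto
  qed
qed

section \<open>Flow and orbits\<close>

text \<open>
  Where a greatest set with the two defining properties exists, maximality singles it out.
\<close>
lemma control_set_iff_greatest:
  assumes "pre_control_set f \<Omega> C" "\<And>D. pre_control_set f \<Omega> D \<Longrightarrow> D \<subseteq> C"
  shows "control_set f \<Omega> D \<longleftrightarrow> D = C"
  using assms unfolding control_set_def by blast

lemma vector_derivative_shift:
  fixes f :: "real \<Rightarrow> complex"
  assumes "(f has_vector_derivative D) (at (a + t))"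
  shows "((\<lambda>s. f (a + s)) has_vector_derivative D) (at t)"
proof -
  have "((\<lambda>s. a + s) has_vector_derivative 1) (at t)"
    by (auto intro!: derivative_eq_intros)
  from vector_diff_chain_at[OF this assms] show ?thesis by (simp add: o_def)
qed

locale rotor_system =
  fixes lam mu um up :: real and \<eta> :: complex
  assumes um: "um < 0" and up: "0 < up" and \<eta>: "\<eta> \<noteq> 0"
    and rate_at_zero: "Complex lam mu \<noteq> 0"
begin

abbreviation adm :: "(real \<Rightarrow> real) set" where "adm \<equiv> admissible {um..up}"
abbreviation \<phi> :: "real \<Rightarrow> complex \<Rightarrow> (real \<Rightarrow> real) \<Rightarrow> complex" where
  "\<phi> \<equiv> flow (rotor_rhs lam mu \<eta>)"
abbreviation Opos :: "complex \<Rightarrow> complex set" where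
  "Opos \<equiv> pos_orbit (rotor_rhs lam mu \<eta>) {um..up}"
abbreviation Oneg :: "complex \<Rightarrow> complex set" where
  "Oneg \<equiv> neg_orbit (rotor_rhs lam mu \<eta>) {um..up}"

definition rate :: "real \<Rightarrow> complex" where "rate c = Complex lam (mu - c)"
definition equi :: "real \<Rightarrow> complex" where "equi c = - (of_real c * \<eta>) / rate c"
definition drift_bound :: real where "drift_bound = max \<bar>um\<bar> \<bar>up\<bar> * norm \<eta>"

text \<open>
  The bound on the translation part is used for \<open>t \<ge> 0\<close> when the orbits are shown to be bounded; for
  negative times the inverse of an affine map serves instead.
\<close>
lemma flow_affine:
  assumes "u \<in> adm"
  obtains a b where "\<And>x. \<phi> t x u = a * x + b" "norm a = exp (lam * t)"
    "lam \<noteq> 0 \<Longrightarrow> t \<ge> 0 \<Longrightarrow> norm b \<le> drift_bound * ((exp (lam * t) - 1) / lam)"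
proof -
  obtain E K where EK: "\<And>x. is_solution (rotor_rhs lam mu \<eta>) x u (\<lambda>t. E t * (x + K t))"
    "\<And>t. norm (E t) = exp (lam * t)"
    "\<And>t. lam \<noteq> 0 \<Longrightarrow> t \<ge> 0 \<Longrightarrow> norm (E t * K t) \<le> drift_bound * ((exp (lam * t) - 1) / lam)"
    unfolding drift_bound_def by (rule solution_formula[OF assms, of lam mu \<eta>]) blast
  from assms obtain S where S: "switching_times u S"
    unfolding admissible_def piecewise_constant_iff by auto
  have "\<phi> t x u = E t * (x + K t)" for x
    using EK(1)[of x] S switching_times_isCont[OF S]
    by (intro flow_eqI[OF assms, where S = S]) (auto simp: is_solution_def switching_times_def)
  then have "\<phi> t x u = E t * x + E t * K t" for x by (simp add: algebra_simps)
  with that EK(2,3) show thesis by blast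
qed

lemma flow_0 [simp]: "u \<in> adm \<Longrightarrow> \<phi> 0 x u = x"
  using flow_is_solution by (simp add: is_solution_def)

text \<open>
  The source of all distance estimates: the flow scales distances by the same factor for all
  controls.
\<close>
lemma norm_flow_diff:
  assumes "u \<in> adm"
  shows "norm (\<phi> t x u - \<phi> t y u) = exp (lam * t) * norm (x - y)"
proof -
  obtain a b where "\<And>x. \<phi> t x u = a * x + b" "norm a = exp (lam * t)"
    using flow_affine[OF assms] by metis
  then show ?thesis by (metis add_diff_cancel_right norm_mult right_diff_distrib)
qed

lemma flow_off_switching_times:
  assumes "u \<in> adm"
  obtains S where "\<And>a b. finite (S \<inter> {a..b})"
    "\<And>x t. t \<notin> S \<Longrightarrow> ((\<lambda>t. \<phi> t x u) has_vector_derivative rotor_rhs lam mu \<eta> (\<phi> t x u) (u t)) (at t)"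
proof -
  from assms obtain S where S: "switching_times u S"
    unfolding admissible_def piecewise_constant_iff by auto
  have "((\<lambda>t. \<phi> t x u) has_vector_derivative rotor_rhs lam mu \<eta> (\<phi> t x u) (u t)) (at t)"
    if "t \<notin> S" for x t
    using flow_is_solution[OF assms] switching_times_isCont[OF S that] unfolding is_solution_def by blast
  with S that show thesis unfolding switching_times_def by blast
qed

lemma continuous_flow: "u \<in> adm \<Longrightarrow> continuous_on UNIV (\<lambda>t. \<phi> t x u)"
  using flow_is_solution by (simp add: is_solution_def)

lemma flow_add:
  assumes "u \<in> adm"
  shows "\<phi> (s + t) x u = \<phi> t (\<phi> s x u) (\<lambda>r. u (s + r))"
proof -
  obtain S where S: "\<And>a b. finite (S \<inter> {a..b})"
    "\<And>x t. t \<notin> S \<Longrightarrow> ((\<lambda>t. \<phi> t x u) has_vector_derivative rotor_rhs lam mu \<eta> (\<phi> t x u) (u t)) (at t)"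
    using flow_off_switching_times[OF assms] by blast
  show ?thesis
  proof (rule flow_eqI[OF admissible_shift[OF assms] locally_finite_shift[OF S(1)], symmetric])
    have "continuous_on UNIV ((\<lambda>t. \<phi> t x u) \<circ> (+) s)"
      by (intro continuous_on_compose continuous_on_subset[OF continuous_flow[OF assms]] continuous_intros) auto
    then show "continuous_on UNIV (\<lambda>t. \<phi> (s + t) x u)" by (simp add: o_def)
  qed (auto intro: vector_derivative_shift S(2))
qed

lemma flow_switch_at:
  assumes u: "u \<in> adm" and w: "w \<in> adm" and t: "t \<ge> 0"
  shows "\<phi> s x (switch_at t u w) = (if s \<le> t then \<phi> s x u else \<phi> (s - t) (\<phi> t x u) w)"
proof -
  obtain S where S: "\<And>a b. finite (S \<inter> {a..b})"
    "\<And>x t. t \<notin> S \<Longrightarrow> ((\<lambda>t. \<phi> t x u) has_vector_derivative rotor_rhs lam mu \<eta> (\<phi> t x u) (u t)) (at t)"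
    using flow_off_switching_times[OF u] by blast
  obtain S' where S': "\<And>a b. finite (S' \<inter> {a..b})"
    "\<And>x t. t \<notin> S' \<Longrightarrow> ((\<lambda>t. \<phi> t x w) has_vector_derivative rotor_rhs lam mu \<eta> (\<phi> t x w) (w t)) (at t)"
    using flow_off_switching_times[OF w] by blast
  let ?S = "insert t (S \<union> {s. - t + s \<in> S'})"
  let ?g = "\<lambda>s. if s \<le> t then \<phi> s x u else \<phi> (s - t) (\<phi> t x u) w"
  show ?thesis
  proof (rule flow_eqI[OF admissible_switch_at[OF u w], where S = ?S])
    show "finite (?S \<inter> {a..b})" for a b
      using S(1) locally_finite_shift[OF S'(1), of "- t" a b] by (simp add: Int_Un_distrib2 Int_insert_left)
    show "continuous_on UNIV ?g"
    proof (rule continuous_on_cases_le)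
      have "continuous_on UNIV ((\<lambda>s. \<phi> s (\<phi> t x u) w) \<circ> (\<lambda>s. s - t))"
        by (intro continuous_on_compose continuous_on_subset[OF continuous_flow[OF w]] continuous_intros) auto
      then show "continuous_on {s \<in> UNIV. t \<le> s} (\<lambda>s. \<phi> (s - t) (\<phi> t x u) w)"
        unfolding o_def by (rule continuous_on_subset) auto
    qed (use w in \<open>auto intro: continuous_on_subset[OF continuous_flow[OF u]]\<close>)
    show "?g 0 = x" using u t by simp
    fix r assume r: "r \<notin> ?S"
    then consider "r < t" | "r > t" by force
    then show "(?g has_vector_derivative rotor_rhs lam mu \<eta> (?g r) (switch_at t u w r)) (at r)"
    proof cases
      case 1
      have "((\<lambda>s. \<phi> s x u) has_vector_derivative rotor_rhs lam mu \<eta> (\<phi> r x u) (u r)) (at r)"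
        using r by (intro S(2)) auto
      then have "(?g has_vector_derivative rotor_rhs lam mu \<eta> (\<phi> r x u) (u r)) (at r)"
        by (rule has_vector_derivative_transform_within_open[where S = "{..<t}"]) (use 1 in auto)
      with 1 show ?thesis by (simp add: switch_at_def)
    next
      case 2
      have "((\<lambda>s. \<phi> (- t + s) (\<phi> t x u) w) has_vector_derivative
          rotor_rhs lam mu \<eta> (\<phi> (- t + r) (\<phi> t x u) w) (w (- t + r))) (at r)"
        using r by (intro vector_derivative_shift S'(2)) auto
      then have "(?g has_vector_derivative
          rotor_rhs lam mu \<eta> (\<phi> (- t + r) (\<phi> t x u) w) (w (- t + r))) (at r)"
        by (rule has_vector_derivative_transform_within_open[where S = "{t<..}"]) (use 2 in auto)
      with 2 show ?thesis by (simp add: switch_at_def)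
    qed
  qed
qed

lemma flow_const:
  assumes c: "c \<in> {um..up}" and nz: "rate c \<noteq> 0"
  shows "\<phi> t x (\<lambda>_. c) = equi c + exp (rate c * of_real t) * (x - equi c)"
proof (rule flow_eqI[OF admissible_const[OF c], where S = "{}"])
  show "continuous_on UNIV (\<lambda>t. equi c + exp (rate c * complex_of_real t) * (x - equi c))"
    by (intro continuous_intros)
  fix t :: real
  have "((\<lambda>z. equi c + exp (rate c * z) * (x - equi c)) has_field_derivative
      rate c * exp (rate c * of_real t) * (x - equi c)) (at (of_real t))"
    by (auto intro!: derivative_eq_intros)
  then have "((\<lambda>t. equi c + exp (rate c * of_real t) * (x - equi c)) has_vector_derivative
      rate c * exp (rate c * of_real t) * (x - equi c)) (at t)"
    by (rule has_vector_derivative_real_field)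
  moreover have "rate c * exp (rate c * of_real t) * (x - equi c) =
      rotor_rhs lam mu \<eta> (equi c + exp (rate c * of_real t) * (x - equi c)) c"
    using nz by (simp add: rotor_rhs_def equi_def rate_def[symmetric] algebra_simps)
  ultimately show "((\<lambda>t. equi c + exp (rate c * of_real t) * (x - equi c)) has_vector_derivative
      rotor_rhs lam mu \<eta> (equi c + exp (rate c * of_real t) * (x - equi c)) c) (at t)"
    by simp
qed auto

lemma rate_nonzero: "lam \<noteq> 0 \<or> c \<noteq> mu \<Longrightarrow> rate c \<noteq> 0"
  by (auto simp: rate_def complex_eq_iff)

text \<open>
  The map \<open>u \<mapsto> v(u)\<close> is a Moebius transformation with determinant \<open>- \<eta> (\<lambda> + \<i> \<mu>)\<close>.
\<close>
lemma equi_inj: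
  assumes "rate c \<noteq> 0" "rate d \<noteq> 0" "equi c = equi d"
  shows "c = d"
proof -
  have "of_real c * rate d = of_real d * rate c"
    using assms \<eta> by (simp add: equi_def field_simps)
  then have "(of_real c - of_real d) * Complex lam mu = 0"
    by (auto simp: rate_def complex_eq_iff algebra_simps)
  with rate_at_zero show ?thesis by simp
qed

lemma pos_orbitI: "u \<in> adm \<Longrightarrow> t \<ge> 0 \<Longrightarrow> \<phi> t x u \<in> Opos x"
  by (auto simp: pos_orbit_def)

lemma pos_orbit_trans:
  assumes "y \<in> Opos x" "z \<in> Opos y"
  shows "z \<in> Opos x"
proof -
  obtain t u s w where *: "y = \<phi> t x u" "t \<ge> 0" "u \<in> adm" "z = \<phi> s y w" "s \<ge> 0" "w \<in> adm"
    using assms by (auto simp: pos_orbit_def)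
  then have "z = \<phi> (t + s) x (switch_at t u w)"
    by (auto simp: flow_switch_at)
  then show ?thesis using * by (auto intro!: pos_orbitI admissible_switch_at)
qed

lemma pos_orbit_refl: "x \<in> Opos x"
  using pos_orbitI[of "\<lambda>_. 0" 0 x] um up by (simp add: admissible_const)

lemma flow_inverse:
  assumes "u \<in> adm"
  shows "\<phi> (- t) (\<phi> t x u) (\<lambda>r. u (t + r)) = x"
  using flow_add[OF assms, of t "- t" x] assms by simp

lemma neg_orbit_iff: "x \<in> Oneg y \<longleftrightarrow> y \<in> Opos x"
proof
  assume "x \<in> Oneg y"
  then obtain t u where *: "x = \<phi> (- t) y u" "t \<ge> 0" "u \<in> adm" by (auto simp: neg_orbit_def)
  then have "y = \<phi> t x (\<lambda>r. u (- t + r))" using flow_inverse[of u "- t" y] by simp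
  moreover have "\<phi> t x (\<lambda>r. u (- t + r)) \<in> Opos x"
    using * by (intro pos_orbitI admissible_shift)
  ultimately show "y \<in> Opos x" by simp
next
  assume "y \<in> Opos x"
  then obtain t u where *: "y = \<phi> t x u" "t \<ge> 0" "u \<in> adm" by (auto simp: pos_orbit_def)
  then have "x = \<phi> (- t) y (\<lambda>r. u (t + r))" using flow_inverse[of u t x] by simp
  then show "x \<in> Oneg y" using * unfolding neg_orbit_def by (blast intro: admissible_shift)
qed

lemma spiral_in_pos_orbit:
  assumes "c \<in> {um..up}" "rate c \<noteq> 0" "s \<ge> 0"
  shows "equi c + exp (rate c * of_real s) * (x - equi c) \<in> Opos x"
  using pos_orbitI[OF admissible_const[OF assms(1)] assms(3), of x] by (simp only: flow_const[OF assms(1,2)])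

section \<open>Reaching a neighbourhood of an equilibrium\<close>

lemma other_control:
  obtains c' where "c' \<in> {um..up}" "c' \<noteq> c"
  using um up by (metis atLeastAtMost_iff order.strict_implies_order order.refl less_irrefl order_less_trans)

lemma exists_regular_control:
  obtains c where "c \<in> {um..up}" "c \<noteq> mu"
  using other_control by blast

text \<open>
  Leave \<open>v(c)\<close> with the control \<open>d\<close> for time \<open>t\<close>, then turn around \<open>v(c)\<close> with the control \<open>c\<close> for
  time \<open>s\<close>.
\<close>
lemma spiral_loop_from_equi:
  assumes c: "c \<in> {um..up}" "rate c \<noteq> 0" and d: "d \<in> {um..up}" "rate d \<noteq> 0" and "s \<ge> 0" "t \<ge> 0"
  shows "equi c + exp (rate c * of_real s) * ((equi d - equi c) * (1 - exp (rate d * of_real t))) \<in> Opos (equi c)"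
proof -
  let ?y = "equi d + exp (rate d * of_real t) * (equi c - equi d)"
  have "?y \<in> Opos (equi c)" using assms by (intro spiral_in_pos_orbit)
  moreover have "equi c + exp (rate c * of_real s) * (?y - equi c) \<in> Opos ?y"
    using assms by (intro spiral_in_pos_orbit)
  moreover have "?y - equi c = (equi d - equi c) * (1 - exp (rate d * of_real t))"
    by (simp add: algebra_simps)
  ultimately show ?thesis using pos_orbit_trans by metis
qed

text \<open>
  The same loop run backwards: the point spirals with the control \<open>c\<close> until it lies on the backward
  arc of \<open>v(c)\<close> under the control \<open>d\<close>, which then carries it to \<open>v(c)\<close>.
\<close>
lemma spiral_loop_to_equi:
  assumes c: "c \<in> {um..up}" "rate c \<noteq> 0" and d: "d \<in> {um..up}" "rate d \<noteq> 0" and "s \<ge> 0" "t \<ge> 0"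
  shows "equi c + exp (rate c * of_real (- s)) * ((equi d - equi c) * (1 - exp (- rate d * of_real t)))
    \<in> Oneg (equi c)" (is "?x \<in> _")
proof -
  let ?y = "equi c + exp (rate c * of_real s) * (?x - equi c)"
  have y: "?y = equi c + (equi d - equi c) * (1 - exp (- rate d * of_real t))"
    by (simp add: exp_minus)
  have "?y \<in> Opos ?x" using assms by (intro spiral_in_pos_orbit)
  moreover have "equi d + exp (rate d * of_real t) * (?y - equi d) \<in> Opos ?y"
    using assms by (intro spiral_in_pos_orbit)
  moreover have "equi d + exp (rate d * of_real t) * (?y - equi d) = equi c"
    unfolding y by (simp add: exp_minus field_simps)
  ultimately show ?thesis unfolding neg_orbit_iff using pos_orbit_trans by metis
qed

lemma exp_rate_norm: "norm (exp (rate c * of_real s)) = exp (lam * s)"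
  by (simp add: norm_exp_eq_Re rate_def)

text \<open>
  The lemma \<open>spiral_meets_arc\<close> yields a time \<open>s\<close> of either sign; comparing the moduli of the point
  and of the point of the arc on its spiral decides which one it is.
\<close>
lemma spiral_time_sign:
  fixes s :: real and g :: complex
  shows "norm g < norm (exp (rate c * s) * g) \<Longrightarrow> lam * s > 0"
    and "norm (exp (rate c * s) * g) < norm g \<Longrightarrow> lam * s < 0"
proof -
  have *: "norm (exp (rate c * s) * g) = exp (lam * s) * norm g"
    by (simp only: norm_mult exp_rate_norm)
  show "lam * s > 0" if "norm g < norm (exp (rate c * s) * g)"
    using that mult_right_mono[of "exp (lam * s)" 1 "norm g"] unfolding * by fastforce
  show "lam * s < 0" if "norm (exp (rate c * s) * g) < norm g"
    using that mult_right_mono[of 1 "exp (lam * s)" "norm g"] unfolding * by fastforce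
qed

text \<open>
  Shortening the arc brings all of it closer to \<open>v(c)\<close> than the target point, so the expanding
  spiral from the arc to the target is followed forwards.
\<close>
lemma pos_orbit_equi_UNIV:
  assumes lam: "lam > 0" and c: "c \<in> {um..up}" "c \<noteq> mu"
  shows "Opos (equi c) = UNIV"
proof -
  obtain d where d: "d \<in> {um..up}" "d \<noteq> c" using other_control by blast
  have nz: "rate c \<noteq> 0" "rate d \<noteq> 0" using lam by (simp_all add: rate_nonzero)
  define q where "q = equi d - equi c"
  have q: "q \<noteq> 0" using equi_inj[OF nz] d(2) by (auto simp: q_def)
  have "z \<in> Opos (equi c)" for z
  proof (cases "z = equi c")
    case False
    define w where "w = z - equi c"
    have w: "w \<noteq> 0" using False by (simp add: w_def)
    have "((\<lambda>t. q * (1 - exp (rate d * of_real t))) \<longlongrightarrow> q * (1 - exp (rate d * of_real 0))) (at_right 0)"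
      by (intro tendsto_intros)
    then have "((\<lambda>t. q * (1 - exp (rate d * of_real t))) \<longlongrightarrow> 0) (at_right 0)" by simp
    then have "\<forall>\<^sub>F t in at_right 0. dist (q * (1 - exp (rate d * of_real t))) 0 < norm w"
      by (rule tendstoD) (simp add: w)
    then obtain T where T: "T > 0" "\<And>t. 0 < t \<Longrightarrow> t < T \<Longrightarrow> norm (q * (1 - exp (rate d * of_real t))) < norm w"
      unfolding eventually_at_right_field by auto
    obtain t1 where t1: "0 < t1" "\<And>z. z \<noteq> 0 \<Longrightarrow>
        \<exists>t\<in>{t1..T / 2}. \<exists>s::real. z = exp (rate c * s) * (q * (1 - exp (rate d * t)))"
      by (rule spiral_meets_arc[of "rate c" "rate d" q "T / 2"])
        (use lam c nz q T in \<open>auto simp: rate_def\<close>)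
    then obtain t and s :: real where ts: "t \<in> {t1..T / 2}" "w = exp (rate c * s) * (q * (1 - exp (rate d * t)))"
      using w by metis
    have less: "norm (q * (1 - exp (rate d * of_real t))) < norm w" using ts(1) t1(1) T(1) by (intro T(2)) auto
    have "s \<ge> 0"
      using less spiral_time_sign[where c = c and s = s and g = "q * (1 - exp (rate d * of_real t))"] lam
      by (auto simp: ts(2)[symmetric] zero_less_mult_iff mult_less_0_iff)
    then have "equi c + w \<in> Opos (equi c)"
      using spiral_loop_from_equi[OF c(1) nz(1) d(1) nz(2), of s t] ts t1(1) by (simp add: q_def)
    then show ?thesis by (simp add: w_def)
  qed (simp add: pos_orbit_refl)
  then show ?thesis by auto
qed

lemma norm_one_minus_exp_ge:
  assumes "Re k < 0" "t \<ge> t\<^sub>1"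
  shows "norm (1 - exp (k * of_real t)) \<ge> 1 - exp (Re k * t\<^sub>1)"
proof -
  have "norm (exp (k * of_real t)) \<le> exp (Re k * t\<^sub>1)"
    using assms by (simp add: norm_exp_eq_Re mult_left_mono_neg)
  then show ?thesis using norm_triangle_ineq2[of 1 "exp (k * of_real t)"] unfolding norm_one by linarith
qed

text \<open>
  A contracting spiral is followed forwards from the arc to the target if the target is the nearer
  one to \<open>v(c)\<close>. The piece of the arc in use keeps the distance \<open>r\<close> from \<open>v(c)\<close>, because the modulus of
  \<open>exp (rate d * t)\<close> is at most \<open>exp (\<lambda> t\<^sub>1) < 1\<close> from its earliest time \<open>t\<^sub>1\<close> on.
\<close>
lemma pos_orbit_equi_interior:
  assumes lam: "lam < 0" and c: "c \<in> {um..up}" "c \<noteq> mu"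
  obtains r where "r > 0" "ball (equi c) r \<subseteq> Opos (equi c)"
proof -
  obtain d where d: "d \<in> {um..up}" "d \<noteq> c" using other_control by blast
  have nz: "rate c \<noteq> 0" "rate d \<noteq> 0" using lam by (simp_all add: rate_nonzero)
  define q where "q = equi d - equi c"
  have q: "q \<noteq> 0" using equi_inj[OF nz] d(2) by (auto simp: q_def)
  obtain t1 where t1: "0 < t1" "\<And>z. z \<noteq> 0 \<Longrightarrow>
      \<exists>t\<in>{t1..1::real}. \<exists>s::real. z = exp (rate c * s) * (q * (1 - exp (rate d * t)))"
    by (rule spiral_meets_arc[of "rate c" "rate d" q 1]) (use lam c nz q in \<open>auto simp: rate_def\<close>)
  define r where "r = norm q * (1 - exp (lam * t1))"
  have "r > 0" using q lam t1(1) by (simp add: r_def mult_neg_pos)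
  moreover have "z \<in> Opos (equi c)" if "z \<in> ball (equi c) r" for z
  proof (cases "z = equi c")
    case False
    define w where "w = z - equi c"
    have w: "w \<noteq> 0" "norm w < r" using False that by (auto simp: w_def dist_norm norm_minus_commute)
    then obtain t and s :: real where ts: "t \<in> {t1..1}" "w = exp (rate c * s) * (q * (1 - exp (rate d * t)))"
      using t1(2) by metis
    have "r \<le> norm (q * (1 - exp (rate d * of_real t)))"
      unfolding r_def norm_mult using norm_one_minus_exp_ge[of "rate d" t1 t] ts(1) lam
      by (intro mult_left_mono) (auto simp: rate_def)
    with w have less: "norm w < norm (q * (1 - exp (rate d * of_real t)))" by simp
    have "s \<ge> 0"
      using less spiral_time_sign[where c = c and s = s and g = "q * (1 - exp (rate d * of_real t))"] lam
      by (auto simp: ts(2)[symmetric] zero_less_mult_iff mult_less_0_iff)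
    then have "equi c + w \<in> Opos (equi c)"
      using spiral_loop_from_equi[OF c(1) nz(1) d(1) nz(2), of s t] ts t1(1) by (simp add: q_def)
    then show ?thesis by (simp add: w_def)
  qed (simp add: pos_orbit_refl)
  ultimately show thesis using that by blast
qed

text \<open>
  Time reversal exchanges contraction and expansion, so this is the argument of the previous lemma
  for the backward arc, on which \<open>rate d\<close> is replaced by its negative.
\<close>
lemma neg_orbit_equi_interior:
  assumes lam: "lam > 0" and c: "c \<in> {um..up}" "c \<noteq> mu"
  obtains r where "r > 0" "ball (equi c) r \<subseteq> Oneg (equi c)"
proof -
  obtain d where d: "d \<in> {um..up}" "d \<noteq> c" using other_control by blast
  have nz: "rate c \<noteq> 0" "rate d \<noteq> 0" using lam by (simp_all add: rate_nonzero)
  define q where "q = equi d - equi c"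
  have q: "q \<noteq> 0" using equi_inj[OF nz] d(2) by (auto simp: q_def)
  obtain t1 where t1: "0 < t1" "\<And>z. z \<noteq> 0 \<Longrightarrow>
      \<exists>t\<in>{t1..1::real}. \<exists>s::real. z = exp (rate c * s) * (q * (1 - exp (- rate d * t)))"
    by (rule spiral_meets_arc[of "rate c" "- rate d" q 1]) (use lam c nz q in \<open>auto simp: rate_def\<close>)
  define r where "r = norm q * (1 - exp (- lam * t1))"
  have "r > 0" using q lam t1(1) by (simp add: r_def)
  moreover have "z \<in> Oneg (equi c)" if "z \<in> ball (equi c) r" for z
  proof (cases "z = equi c")
    case False
    define w where "w = z - equi c"
    have w: "w \<noteq> 0" "norm w < r" using False that by (auto simp: w_def dist_norm norm_minus_commute)
    then obtain t and s :: real where ts: "t \<in> {t1..1}" "w = exp (rate c * s) * (q * (1 - exp (- rate d * t)))"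
      using t1(2) by metis
    have "r \<le> norm (q * (1 - exp (- rate d * of_real t)))"
      unfolding r_def norm_mult using norm_one_minus_exp_ge[of "- rate d" t1 t] ts(1) lam
      by (intro mult_left_mono) (auto simp: rate_def)
    with w have less: "norm w < norm (q * (1 - exp (- rate d * of_real t)))" by simp
    have "s \<le> 0"
      using less spiral_time_sign[where c = c and s = s and g = "q * (1 - exp (- rate d * of_real t))"] lam
      by (simp only: ts(2)[symmetric]) (simp add: mult_less_0_iff)
    then have "equi c + w \<in> Oneg (equi c)"
      using spiral_loop_to_equi[OF c(1) nz(1) d(1) nz(2), of "- s" t] ts t1(1) by (simp add: q_def)
    then show ?thesis by (simp add: w_def)
  qed (simp add: neg_orbit_iff pos_orbit_refl)
  ultimately show thesis using that by blast
qed

section \<open>The undamped system\<close>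

text \<open>
  Control \<open>c\<close> rotates about \<open>v(c)\<close> with angular velocity \<open>\<mu> - c\<close>. Adding a full turn in the direction
  of rotation makes the required time nonnegative.
\<close>
lemma rotation_in_pos_orbit:
  assumes lam: "lam = 0" and c: "c \<in> {um..up}" "c \<noteq> mu"
    and eq: "norm (y - equi c) = norm (x - equi c)"
  shows "y \<in> Opos x"
proof (cases "x = equi c")
  case True
  then show ?thesis using eq pos_orbit_refl by simp
next
  case False
  define a where "a = (y - equi c) / (x - equi c)"
  have "norm a = 1" using eq False by (simp add: a_def norm_divide)
  then have a: "a = exp (\<i> * Arg a)" by (metis Arg_eq mult_1 norm_zero of_real_1 zero_neq_one)
  \<comment> \<open>As \<open>Arg a\<close> lies between \<open>- \<pi>\<close> and \<open>\<pi>\<close>, one full turn is enough.\<close>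
  define k :: int where "k = (if mu - c > 0 then 1 else - 1)"
  define t where "t = (Arg a + 2 * pi * of_int k) / (mu - c)"
  have "t \<ge> 0"
    using Arg_bounded[of a] c(2) by (auto simp: t_def k_def divide_nonpos_nonpos)
  have "exp (rate c * of_real t) = exp (\<i> * Arg a + of_int k * (of_real (2 * pi) * \<i>))"
  proof (rule arg_cong[where f = exp])
    have "rate c = \<i> * of_real (mu - c)"
      unfolding rate_def using lam by (simp add: complex_eq_iff)
    then have "rate c * of_real t = \<i> * of_real ((mu - c) * t)" by simp
    also have "(mu - c) * t = Arg a + 2 * pi * of_int k" using c(2) by (simp add: t_def)
    finally show "rate c * of_real t = \<i> * Arg a + of_int k * (of_real (2 * pi) * \<i>)"
      by (simp add: algebra_simps)
  qed
  also have "\<dots> = a" using a exp_integer_2pi[of "of_int k"] by (simp add: exp_add mult_ac)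
  finally have "equi c + exp (rate c * of_real t) * (x - equi c) = y"
    using False by (simp add: a_def)
  then show ?thesis
    using spiral_in_pos_orbit[OF c(1) _ \<open>t \<ge> 0\<close>, of x] rate_nonzero[of c] c(2) by simp
qed

text \<open>
  Rotate \<open>x\<close> about \<open>0\<close> to the point \<open>p\<close> opposite to the second centre \<open>q\<close>. The circle about \<open>q\<close>
  through \<open>p\<close> then runs from modulus \<open>|x|\<close> to modulus \<open>|x| + 2 |q|\<close>, so it contains a point \<open>p'\<close> of the
  modulus of \<open>y\<close>, which a rotation about \<open>0\<close> takes to \<open>y\<close>. Since a rotation can be continued to a full
  turn, every step can be reversed.
\<close>
lemma norm_growth_by_two_rotations:
  assumes lam: "lam = 0" and c: "c \<in> {um..up}" "c \<noteq> mu" "c \<noteq> 0"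
    and y: "norm x \<le> norm y" "norm y \<le> norm x + 2 * norm (equi c)"
  shows "y \<in> Opos x \<and> x \<in> Opos y"
proof -
  define q where "q = equi c"
  have mu: "mu \<noteq> 0" using rate_at_zero lam by (auto simp: complex_eq_iff)
  have q: "q \<noteq> 0" using c \<eta> rate_nonzero[of c] by (simp add: q_def equi_def)
  have zero: "equi 0 = 0" by (simp add: equi_def)
  have about_0: "w \<in> Opos z" if "norm w = norm z" for w z
    using rotation_in_pos_orbit[OF lam, of 0 w z] mu um up that by (simp add: zero)
  define p where "p = - (norm x / norm q) * q"
  have p: "norm p = norm x" using q by (simp add: p_def norm_mult norm_divide)
  define g where "g \<theta> = norm (q + exp (\<i> * of_real \<theta>) * (p - q))" for \<theta> :: real
  have "q + exp (\<i> * of_real pi) * (p - q) = of_real (2 + norm x / norm q) * q"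
    unfolding exp_pi_i' p_def by (simp add: algebra_simps)
  then have "g pi = \<bar>2 + norm x / norm q\<bar> * norm q"
    unfolding g_def by (simp only: norm_mult norm_of_real)
  also have "\<bar>2 + norm x / norm q\<bar> = 2 + norm x / norm q"
    by (intro abs_of_nonneg add_nonneg_nonneg divide_nonneg_nonneg) auto
  also have "(2 + norm x / norm q) * norm q = norm x + 2 * norm q" using q by (simp add: field_simps)
  finally have "g 0 \<le> norm y" "norm y \<le> g pi"
    using y p by (auto simp: g_def q_def)
  moreover have "continuous_on {0..pi} g"
    unfolding g_def by (intro continuous_intros)
  ultimately obtain \<theta> where \<theta>: "g \<theta> = norm y"
    using IVT'[of g 0 "norm y" pi] by auto
  define p' where "p' = q + exp (\<i> * of_real \<theta>) * (p - q)"
  have "p \<in> Opos x \<and> x \<in> Opos p" using about_0 p by simp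
  moreover have "p' \<in> Opos p \<and> p \<in> Opos p'"
    using rotation_in_pos_orbit[OF lam c(1,2)]
    by (simp add: p'_def q_def[symmetric] norm_mult)
  moreover have "y \<in> Opos p' \<and> p' \<in> Opos y"
    using about_0 \<theta> by (simp add: g_def p'_def)
  ultimately show ?thesis using pos_orbit_trans by blast
qed

lemma pos_orbit_UNIV_if_no_damping:
  assumes lam: "lam = 0"
  shows "Opos x = UNIV"
proof -
  have mu: "mu \<noteq> 0" using rate_at_zero lam by (auto simp: complex_eq_iff)
  obtain c where c: "c \<in> {um..up}" "c \<noteq> mu" "c \<noteq> 0"
  proof -
    have "infinite {um..up}" using um up by simp
    then have "\<not> {um..up} \<subseteq> {mu, 0}" by (metis finite.simps finite_subset)
    then show thesis using that by blast
  qed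
  define r where "r = 2 * norm (equi c)"
  have r: "r > 0" using c \<eta> rate_nonzero[of c] by (simp add: r_def equi_def)
  have grow: "y \<in> Opos x \<and> x \<in> Opos y"
    if "norm x \<le> norm y" "norm y \<le> norm x + of_nat n * r" for n x y
    using that
  proof (induction n arbitrary: y)
    case 0
    then show ?case by (intro norm_growth_by_two_rotations[OF lam c]) auto
  next
    case (Suc n)
    show ?case
    proof (cases "norm y \<le> norm x + of_nat n * r")
      case False
      define z where "z = complex_of_real (norm x + of_nat n * r)"
      have nz: "norm z = norm x + of_nat n * r"
        using r unfolding z_def norm_of_real by (intro abs_of_nonneg) simp
      have "z \<in> Opos x \<and> x \<in> Opos z" by (rule Suc.IH) (use nz r in auto)
      moreover have "y \<in> Opos z \<and> z \<in> Opos y"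
        by (rule norm_growth_by_two_rotations[OF lam c])
          (use Suc.prems(2) False nz in \<open>auto simp: r_def[symmetric] algebra_simps\<close>)
      ultimately show ?thesis using pos_orbit_trans by blast
    qed (use Suc in simp)
  qed
  have both: "y \<in> Opos x \<and> x \<in> Opos y" if "norm x \<le> norm y" for x y
  proof -
    obtain n where "norm y - norm x < of_nat n * r"
      using ex_less_of_nat_mult[OF r] by blast
    with that grow[of x y n] show ?thesis by simp
  qed
  have "y \<in> Opos x" for y using both[of x y] both[of y x] by linarith
  then show ?thesis by auto
qed

theorem control_set_iff_if_lam_zero:
  assumes "lam = 0"
  shows "control_set (rotor_rhs lam mu \<eta>) {um..up} D \<longleftrightarrow> D = UNIV"
proof (rule control_set_iff_greatest)
  show "pre_control_set (rotor_rhs lam mu \<eta>) {um..up} UNIV"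
    unfolding pre_control_set_def
    using um up admissible_const[of 0 "{um..up}"] by (auto simp: pos_orbit_UNIV_if_no_damping[OF assms])
qed simp

section \<open>Distance to an invariant set\<close>

text \<open>
  Compare \<open>x\<close> with a nearest point of \<open>K\<close>, which stays in \<open>K\<close>. The time may be negative, and then the
  lemma is about sets that are invariant backwards.
\<close>
lemma infdist_flow_le:
  assumes u: "u \<in> adm" and K: "closed K" "K \<noteq> {}" "\<And>y. y \<in> K \<Longrightarrow> \<phi> t y u \<in> K"
  shows "infdist (\<phi> t x u) K \<le> exp (lam * t) * infdist x K"
proof -
  obtain y where y: "y \<in> K" "infdist x K = dist x y"
    using infdist_attains_inf[OF K(1,2)] by blast
  have "infdist (\<phi> t x u) K \<le> dist (\<phi> t x u) (\<phi> t y u)"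
    using K(3)[OF y(1)] by (rule infdist_le)
  then show ?thesis using y(2) norm_flow_diff[OF u] by (simp add: dist_norm)
qed

lemma continuous_flow_initial:
  assumes "u \<in> adm"
  shows "continuous_on UNIV (\<lambda>x. \<phi> t x u)"
proof -
  obtain a b where "\<And>x. \<phi> t x u = a * x + b" using flow_affine[OF assms] by metis
  then show ?thesis by (simp add: continuous_intros)
qed

lemma flow_closure_subset:
  assumes "u \<in> adm" "\<And>y. y \<in> K \<Longrightarrow> \<phi> t y u \<in> K" "x \<in> closure K"
  shows "\<phi> t x u \<in> closure K"
proof -
  have "(\<lambda>x. \<phi> t x u) ` closure K \<subseteq> closure K"
    by (rule image_closure_subset)
      (use assms closure_subset in \<open>auto intro: continuous_on_subset[OF continuous_flow_initial]\<close>)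
  with assms(3) show ?thesis by auto
qed

lemma closure_pos_orbit_trans:
  assumes "y \<in> closure (Opos x)"
  shows "closure (Opos y) \<subseteq> closure (Opos x)"
proof (rule closure_minimal)
  show "Opos y \<subseteq> closure (Opos x)"
  proof
    fix z assume "z \<in> Opos y"
    then obtain t u where z: "z = \<phi> t y u" "t \<ge> 0" "u \<in> adm" by (auto simp: pos_orbit_def)
    show "z \<in> closure (Opos x)"
      unfolding z(1) by (rule flow_closure_subset[OF z(3) _ assms])
        (use z pos_orbit_trans pos_orbitI in blast)
  qed
qed simp

section \<open>Control sets of a contracting flow\<close>

lemma norm_forward_flow_le:
  assumes "u \<in> adm" "lam < 0" "t \<ge> 0"
  shows "norm (\<phi> t x u) \<le> norm x + drift_bound / \<bar>lam\<bar>"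
proof -
  obtain a b where ab: "\<And>x. \<phi> t x u = a * x + b" "norm a = exp (lam * t)"
    "norm b \<le> drift_bound * ((exp (lam * t) - 1) / lam)"
    using flow_affine[OF assms(1), of t] assms(2,3) by (metis less_irrefl)
  have "norm (a * x) \<le> norm x"
    unfolding norm_mult ab(2) using assms(2,3)
    by (intro mult_left_le_one_le) (auto simp: mult_nonpos_nonneg)
  moreover have "drift_bound * ((exp (lam * t) - 1) / lam) \<le> drift_bound * (1 / \<bar>lam\<bar>)"
    using assms(2) by (intro mult_left_mono) (auto simp: drift_bound_def field_simps mult_le_0_iff)
  ultimately show ?thesis
    using ab(3) norm_triangle_ineq[of "a * x" b] by (simp add: ab(1))
qed

lemma equi_in_closure_pos_orbit:
  assumes lam: "lam < 0" and c: "c \<in> {um..up}"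
  shows "equi c \<in> closure (Opos x)"
  unfolding closure_sequential
proof (intro exI conjI allI)
  have nz: "rate c \<noteq> 0" using lam by (simp add: rate_nonzero)
  let ?X = "\<lambda>n. equi c + exp (rate c * of_real (real n)) * (x - equi c)"
  show "?X n \<in> Opos x" for n
    by (rule spiral_in_pos_orbit[OF c nz]) simp
  have "(\<lambda>n. norm (exp (rate c * of_real (real n)))) \<longlonglongrightarrow> 0"
    unfolding exp_rate_norm exp_of_nat2_mult using lam by (intro LIMSEQ_power_zero) simp
  then have "(\<lambda>n. exp (rate c * of_real (real n))) \<longlonglongrightarrow> 0"
    by (rule tendsto_norm_zero_cancel)
  then have "?X \<longlonglongrightarrow> equi c + 0 * (x - equi c)"
    by (intro tendsto_intros)
  then show "?X \<longlonglongrightarrow> equi c" by simp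
qed

text \<open>
  A set with the two properties contains, along with a point \<open>x\<close>, the position \<open>y\<close> at time \<open>1\<close> of some
  trajectory from \<open>x\<close>, and \<open>x\<close> is in turn a limit of points reachable from \<open>y\<close>. Distances to \<open>C\<close> never increase
  along trajectories, so \<open>x\<close> is at most as far from \<open>C\<close> as \<open>y\<close>, but the distance of \<open>y\<close> is smaller by
  the factor \<open>exp \<lambda> < 1\<close>. Hence both vanish.
\<close>
theorem control_set_iff_if_lam_neg:
  assumes lam: "lam < 0" and c: "c \<in> {um..up}"
  shows "control_set (rotor_rhs lam mu \<eta>) {um..up} D \<longleftrightarrow> D = closure (Opos (equi c))"
proof (rule control_set_iff_greatest)
  let ?C = "closure (Opos (equi c))"
  have inv: "\<phi> t x u \<in> ?C" if "x \<in> ?C" "u \<in> adm" "t \<ge> 0" for x t u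
    by (rule flow_closure_subset[OF that(2) _ that(1)]) (use that pos_orbit_trans pos_orbitI in blast)
  have least: "?C \<subseteq> closure (Opos x)" for x
    by (rule closure_pos_orbit_trans[OF equi_in_closure_pos_orbit[OF lam c]])
  have "\<exists>u\<in>adm. (\<lambda>t. \<phi> t x u) ` {0..} \<subseteq> ?C" if "x \<in> ?C" for x
    using that inv admissible_const[OF c] by (intro bexI[of _ "\<lambda>_. c"]) auto
  then show "pre_control_set (rotor_rhs lam mu \<eta>) {um..up} ?C"
    unfolding pre_control_set_def using least by blast
  fix D assume D: "pre_control_set (rotor_rhs lam mu \<eta>) {um..up} D"
  show "D \<subseteq> ?C"
  proof
    fix x assume x: "x \<in> D"
    then obtain u where u: "u \<in> adm" "(\<lambda>t. \<phi> t x u) ` {0..} \<subseteq> D"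
      using D unfolding pre_control_set_def by blast
    define y where "y = \<phi> 1 x u"
    have "y \<in> D" using u(2) by (auto simp: y_def)
    then have xy: "x \<in> closure (Opos y)" using D x unfolding pre_control_set_def by blast
    have ne: "?C \<noteq> {}" using pos_orbit_refl closure_subset by blast
    have "infdist x ?C \<le> infdist y ?C"
    proof (rule continuous_le_on_closure[OF _ xy])
      fix z assume "z \<in> Opos y"
      then obtain t w where z: "z = \<phi> t y w" "t \<ge> 0" "w \<in> adm" by (auto simp: pos_orbit_def)
      then have "infdist z ?C \<le> exp (lam * t) * infdist y ?C"
        using infdist_flow_le[OF z(3) closed_closure ne] inv by blast
      also have "\<dots> \<le> infdist y ?C"
        using lam z(2) by (intro mult_left_le_one_le) (auto simp: mult_nonpos_nonneg infdist_nonneg)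
      finally show "infdist z ?C \<le> infdist y ?C" .
    qed (intro continuous_intros)
    also have "infdist y ?C \<le> exp (lam * 1) * infdist x ?C"
      unfolding y_def by (intro infdist_flow_le u closed_closure ne inv) auto
    finally have "(1 - exp lam) * infdist x ?C \<le> 0" by (simp add: algebra_simps)
    moreover have "1 - exp lam > 0" using lam by simp
    ultimately have "infdist x ?C = 0"
      using infdist_nonneg[of x ?C] by (simp add: mult_le_0_iff)
    then show "x \<in> ?C" using in_closed_iff_infdist_zero[OF closed_closure ne] by simp
  qed
qed

lemma bounded_pos_orbit:
  assumes "lam < 0"
  shows "bounded (Opos x)"
  unfolding bounded_iff
  by (rule exI[of _ "norm x + drift_bound / \<bar>lam\<bar>"])
    (auto simp: pos_orbit_def intro: norm_forward_flow_le assms)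

text \<open>
  The point \<open>v(c)\<close> itself may be one around which the system does not rotate; the interior point
  is supplied by another equilibrium, whose positive orbit has the same closure.
\<close>
lemma interior_closure_pos_orbit:
  assumes lam: "lam < 0" and c: "c \<in> {um..up}"
  shows "interior (closure (Opos (equi c))) \<noteq> {}"
proof -
  obtain d where d: "d \<in> {um..up}" "d \<noteq> mu" using exists_regular_control by blast
  obtain r where r: "r > 0" "ball (equi d) r \<subseteq> Opos (equi d)"
    using pos_orbit_equi_interior[OF lam d] .
  have "Opos (equi d) \<subseteq> closure (Opos (equi c))"
    using closure_pos_orbit_trans[OF equi_in_closure_pos_orbit[OF lam d(1)]] closure_subset by blast
  then have "ball (equi d) r \<subseteq> interior (closure (Opos (equi c)))"
    using r(2) by (intro interior_maximal) auto
  with r(1) show ?thesis by auto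
qed

section \<open>Control sets of an expanding flow\<close>

text \<open>
  A control steering \<open>y\<close> to \<open>v(c)\<close> steers all points near \<open>y\<close> into the ball around \<open>v(c)\<close> that is
  contained in the negative orbit.
\<close>
lemma open_neg_orbit_equi:
  assumes lam: "lam > 0" and c: "c \<in> {um..up}" "c \<noteq> mu"
  shows "open (Oneg (equi c))"
  unfolding open_contains_ball
proof
  fix y assume "y \<in> Oneg (equi c)"
  then have "equi c \<in> Opos y" by (simp add: neg_orbit_iff)
  then obtain t u where t: "equi c = \<phi> t y u" "t \<ge> 0" "u \<in> adm" by (auto simp: pos_orbit_def)
  obtain r where r: "r > 0" "ball (equi c) r \<subseteq> Oneg (equi c)"
    using neg_orbit_equi_interior[OF lam c] .
  have "z \<in> Oneg (equi c)" if "z \<in> ball y (r / exp (lam * t))" for z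
  proof -
    have "\<phi> t z u \<in> ball (equi c) r"
      using that norm_flow_diff[OF t(3), of t y z] by (simp add: t(1) dist_norm field_simps)
    then have "equi c \<in> Opos (\<phi> t z u)" using r(2) neg_orbit_iff by blast
    then show ?thesis using t pos_orbitI pos_orbit_trans unfolding neg_orbit_iff by blast
  qed
  moreover have "r / exp (lam * t) > 0" using r(1) by simp
  ultimately show "\<exists>e>0. ball y e \<subseteq> Oneg (equi c)" by blast
qed

text \<open>
  The comparison of distances of the contracting case, run backwards, confines sets with the two
  properties only to the closure of the negative orbit \<open>R\<close>: as \<open>R\<close> is open, points of its boundary
  are not excluded by distance. This is where the interior of the control set is used.
\<close>
theorem control_set_iff_if_lam_pos:
  assumes lam: "lam > 0" and c: "c \<in> {um..up}" "c \<noteq> mu"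
  shows "control_set (rotor_rhs lam mu \<eta>) {um..up} D \<and> interior D \<noteq> {} \<longleftrightarrow> D = Oneg (equi c)"
proof -
  let ?R = "Oneg (equi c)"
  let ?pre = "pre_control_set (rotor_rhs lam mu \<eta>) {um..up}"
  have op: "open ?R" by (rule open_neg_orbit_equi[OF lam c])
  have mem: "equi c \<in> ?R" by (simp add: neg_orbit_iff pos_orbit_refl)
  have nz: "rate c \<noteq> 0" using lam by (simp add: rate_nonzero)
  have all: "Opos x = UNIV" if "x \<in> ?R" for x
  proof -
    have "z \<in> Opos x" for z
      using that pos_orbit_equi_UNIV[OF lam c] pos_orbit_trans unfolding neg_orbit_iff by blast
    then show ?thesis by auto
  qed
  \<comment> \<open>Steer \<open>x\<close> to \<open>v(c)\<close> and rest there; on the way the trajectory stays in \<open>R\<close>, as all its points reach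
      \<open>v(c)\<close>.\<close>
  have stay: "\<exists>u\<in>adm. (\<lambda>t. \<phi> t x u) ` {0..} \<subseteq> ?R" if x: "x \<in> ?R" for x
  proof -
    obtain t u where t: "equi c = \<phi> t x u" "t \<ge> 0" "u \<in> adm"
      using x unfolding neg_orbit_iff by (auto simp: pos_orbit_def)
    let ?w = "switch_at t u (\<lambda>_. c)"
    have "\<phi> s x ?w \<in> ?R" if "s \<ge> 0" for s
    proof (cases "s \<le> t")
      case True
      have "equi c = \<phi> (t - s) (\<phi> s x u) (\<lambda>r. u (s + r))"
        using flow_add[OF t(3), of s "t - s" x] t(1) by simp
      then have "equi c \<in> Opos (\<phi> s x u)"
        using True pos_orbitI[OF admissible_shift[OF t(3)], of "t - s"] by (metis diff_ge_0_iff_ge)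
      then show ?thesis
        using True by (simp add: neg_orbit_iff flow_switch_at[OF t(3) admissible_const[OF c(1)] t(2)])
    next
      case False
      then have "\<phi> s x ?w = equi c"
        using flow_const[OF c(1) nz, of "s - t" "equi c"]
        by (simp add: flow_switch_at[OF t(3) admissible_const[OF c(1)] t(2)] t(1)[symmetric])
      then show ?thesis using mem by simp
    qed
    moreover have "?w \<in> adm" by (intro admissible_switch_at t admissible_const c)
    ultimately show ?thesis by (intro bexI[of _ ?w]) auto
  qed
  have pre: "?pre ?R"
    unfolding pre_control_set_def using stay all by auto
  \<comment> \<open>Orbits of points of such a set come close to \<open>R\<close> and so enter this open set.\<close>
  have absorb: "D \<subseteq> ?R" if D: "?pre D" and meet: "D \<inter> ?R \<noteq> {}" for D
  proof
    fix x assume x: "x \<in> D"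
    obtain y where y: "y \<in> D" "y \<in> ?R" using meet by blast
    then have "y \<in> closure (Opos x)" using D x unfolding pre_control_set_def by blast
    then obtain z where "z \<in> Opos x" "z \<in> ?R"
      using op y(2) open_Int_closure_eq_empty[of ?R "Opos x"] by blast
    then show "x \<in> ?R" using pos_orbit_trans unfolding neg_orbit_iff by blast
  qed
  let ?K = "closure ?R"
  have ne: "?K \<noteq> {}" using mem closure_subset by blast
  have inv: "\<phi> (- t) x u \<in> ?K" if "x \<in> ?K" "u \<in> adm" "t \<ge> 0" for x t u
  proof (rule flow_closure_subset[OF that(2) _ that(1)])
    fix y assume "y \<in> ?R"
    moreover have "\<phi> (- t) y u \<in> Oneg y" using that by (auto simp: neg_orbit_def)
    ultimately show "\<phi> (- t) y u \<in> ?R" using pos_orbit_trans unfolding neg_orbit_iff by blast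
  qed
  have backward_contraction: "infdist x ?K \<le> exp (- lam * t) * infdist (\<phi> t x u) ?K" if "u \<in> adm" "t \<ge> 0" for x t u
  proof -
    have "infdist (\<phi> (- t) (\<phi> t x u) (\<lambda>r. u (t + r))) ?K \<le> exp (lam * (- t)) * infdist (\<phi> t x u) ?K"
      using that by (intro infdist_flow_le closed_closure ne admissible_shift inv)
    then show ?thesis by (simp add: flow_inverse[OF that(1)])
  qed
  have near: "D \<subseteq> ?K" if D: "?pre D" for D
  proof
    fix x assume x: "x \<in> D"
    then obtain u where u: "u \<in> adm" "(\<lambda>t. \<phi> t x u) ` {0..} \<subseteq> D"
      using D unfolding pre_control_set_def by blast
    define y where "y = \<phi> 1 x u"
    have "y \<in> D" using u(2) by (auto simp: y_def)
    then have xy: "x \<in> closure (Opos y)" using D x unfolding pre_control_set_def by blast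
    have "infdist x ?K \<ge> infdist y ?K"
    proof (rule continuous_ge_on_closure[OF _ xy])
      fix z assume "z \<in> Opos y"
      then obtain t w where z: "z = \<phi> t y w" "t \<ge> 0" "w \<in> adm" by (auto simp: pos_orbit_def)
      then have "infdist y ?K \<le> exp (- lam * t) * infdist z ?K" using backward_contraction by blast
      also have "\<dots> \<le> infdist z ?K"
        using lam z(2) by (intro mult_left_le_one_le) (auto simp: infdist_nonneg)
      finally show "infdist y ?K \<le> infdist z ?K" .
    qed (intro continuous_intros)
    moreover have "infdist x ?K \<le> exp (- lam * 1) * infdist y ?K"
      unfolding y_def using backward_contraction[OF u(1), of 1 x] by simp
    ultimately have "(1 - exp (- lam)) * infdist y ?K \<le> 0" by (simp add: algebra_simps)
    moreover have "1 - exp (- lam) > 0" using lam by simp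
    ultimately have "infdist y ?K = 0"
      using infdist_nonneg[of y ?K] by (simp add: mult_le_0_iff)
    then have "infdist x ?K = 0"
      using backward_contraction[OF u(1), of 1 x] infdist_nonneg[of x ?K] by (simp add: y_def)
    then show "x \<in> ?K" using in_closed_iff_infdist_zero[OF closed_closure ne] by simp
  qed
  show ?thesis
  proof
    assume D: "control_set (rotor_rhs lam mu \<eta>) {um..up} D \<and> interior D \<noteq> {}"
    then have preD: "?pre D" by (simp add: control_set_def)
    have "interior D \<inter> ?K \<noteq> {}" using near[OF preD] D interior_subset by blast
    then have "interior D \<inter> ?R \<noteq> {}"
      using open_Int_closure_eq_empty[of "interior D" ?R] by auto
    then have "D \<subseteq> ?R" using interior_subset by (intro absorb preD) blast
    then show "D = ?R" using D pre unfolding control_set_def by blast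
  next
    assume "D = ?R"
    moreover have "control_set (rotor_rhs lam mu \<eta>) {um..up} ?R"
      unfolding control_set_def using pre absorb mem by blast
    moreover have "interior ?R \<noteq> {}" using op mem by (auto simp: interior_open)
    ultimately show "control_set (rotor_rhs lam mu \<eta>) {um..up} D \<and> interior D \<noteq> {}" by simp
  qed
qed

text \<open>
  Solving \<open>\<phi> t x u = a x + b\<close> for \<open>x\<close> divides \<open>b\<close> by \<open>a\<close>, whose modulus \<open>exp (\<lambda> t)\<close> compensates the growth
  of the bound on \<open>b\<close>.
\<close>
lemma norm_backward_flow_le:
  assumes "u \<in> adm" "lam > 0" "t \<ge> 0"
  shows "norm x \<le> norm (\<phi> t x u) + drift_bound / lam"
proof -
  obtain a b where ab: "\<And>x. \<phi> t x u = a * x + b" "norm a = exp (lam * t)"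
    "norm b \<le> drift_bound * ((exp (lam * t) - 1) / lam)"
    using flow_affine[OF assms(1), of t] assms(2,3) by (metis less_irrefl)
  have D: "drift_bound \<ge> 0" by (simp add: drift_bound_def)
  have e: "exp (lam * t) \<ge> 1" using assms by simp
  have "exp (lam * t) * norm x = norm (a * x)" by (simp add: norm_mult ab(2))
  also have "\<dots> \<le> norm (\<phi> t x u) + norm b"
    using norm_triangle_ineq4[of "a * x + b" b] by (simp add: ab(1))
  also have "\<dots> \<le> exp (lam * t) * norm (\<phi> t x u) + exp (lam * t) * (drift_bound / lam)"
  proof (rule add_mono)
    show "norm (\<phi> t x u) \<le> exp (lam * t) * norm (\<phi> t x u)"
      using e mult_right_mono[OF e, of "norm (\<phi> t x u)"] by simp
    have "drift_bound * ((exp (lam * t) - 1) / lam) \<le> drift_bound * (exp (lam * t) / lam)"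
      using assms(2) D by (intro mult_left_mono divide_right_mono) auto
    then show "norm b \<le> exp (lam * t) * (drift_bound / lam)"
      using ab(3) by (simp add: mult.commute)
  qed
  finally have "exp (lam * t) * norm x \<le> exp (lam * t) * (norm (\<phi> t x u) + drift_bound / lam)"
    by (simp add: distrib_left)
  then show ?thesis by simp
qed

lemma bounded_neg_orbit:
  assumes "lam > 0"
  shows "bounded (Oneg x)"
  unfolding bounded_iff
proof (intro exI ballI)
  fix y assume "y \<in> Oneg x"
  then obtain t u where "x = \<phi> t y u" "t \<ge> 0" "u \<in> adm"
    unfolding neg_orbit_iff by (auto simp: pos_orbit_def)
  then show "norm y \<le> norm x + drift_bound / lam"
    using norm_backward_flow_le assms by blast
qed

end

section \<open>Transport from the complex plane to the real plane\<close>

text \<open>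
  A linear isomorphism that turns \<open>affine_rhs\<close> into \<open>rotor_rhs\<close>; control sets are transported along it.
\<close>
definition to_complex :: "real^2 \<Rightarrow> complex" where
  "to_complex v = Complex (v $ 1) (v $ 2)"

lemma linear_to_complex: "linear to_complex"
  by (rule linearI) (simp_all add: to_complex_def complex_eq_iff)

lemma bij_to_complex: "bij to_complex"
proof (rule bijI)
  show "inj to_complex"
    by (rule injI) (simp add: to_complex_def vec_eq_iff forall_2)
  have "to_complex (vector [Re z, Im z]) = z" for z
    by (simp add: to_complex_def)
  then show "surj to_complex" by (rule surjI)
qed

lemma to_complex_affine_rhs:
  "to_complex (affine_rhs (A_mat lam mu) \<eta> v u) = rotor_rhs lam mu (to_complex \<eta>) (to_complex v) u"
  by (simp add: to_complex_def affine_rhs_def rotor_rhs_def A_mat_def theta_def complex_eq_iff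
      matrix_vector_mult_def sum_2 algebra_simps)

lemma bounded_linear_bij:
  fixes h :: "'a::euclidean_space \<Rightarrow> 'b::euclidean_space"
  assumes "linear h" "bij h"
  shows "bounded_linear h" "bounded_linear (inv h)"
proof -
  have sinj: "\<And>x. inv h (h x) = x" and surj: "\<And>y. \<exists>x. y = h x"
    using assms(2) by (auto simp: bij_is_inj bij_is_surj surjD)
  have "linear (inv h)"
  proof (rule linearI)
    fix x y and r :: real
    obtain a b where "x = h a" "y = h b" using surj by metis
    then show "inv h (x + y) = inv h x + inv h y" "inv h (r *\<^sub>R x) = r *\<^sub>R inv h x"
      by (simp_all add: sinj flip: linear_add[OF assms(1)] linear_cmul[OF assms(1)])
  qed
  with assms(1) show "bounded_linear h" "bounded_linear (inv h)"
    by (simp_all add: linear_conv_bounded_linear)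
qed

lemma is_solution_linear_image:
  fixes h :: "'a::euclidean_space \<Rightarrow> 'b::euclidean_space"
  assumes h: "linear h" "bij h" and conj: "\<And>v u. h (f v u) = g (h v) u"
  shows "is_solution g (h x) u (h \<circ> \<gamma>) \<longleftrightarrow> is_solution f x u \<gamma>"
proof -
  note bl = bounded_linear_bij[OF h]
  have inv: "inv h \<circ> (h \<circ> \<gamma>) = \<gamma>" using h by (auto simp: bij_is_inj)
  have "continuous_on UNIV (h \<circ> \<gamma>) \<longleftrightarrow> continuous_on UNIV \<gamma>"
    using bounded_linear.continuous_on[OF bl(1), of UNIV \<gamma>]
      bounded_linear.continuous_on[OF bl(2), of UNIV "h \<circ> \<gamma>"] inv unfolding o_def by metis
  moreover have "((h \<circ> \<gamma>) has_vector_derivative g ((h \<circ> \<gamma>) t) (u t)) (at t) \<longleftrightarrow>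
      (\<gamma> has_vector_derivative f (\<gamma> t) (u t)) (at t)" for t
    using bounded_linear.has_vector_derivative[OF bl(1), of \<gamma> "f (\<gamma> t) (u t)" "at t"]
      bounded_linear.has_vector_derivative[OF bl(2), of "h \<circ> \<gamma>" "h (f (\<gamma> t) (u t))" "at t"] inv
    using h by (auto simp: o_def conj[symmetric] bij_is_inj)
  moreover have "h (\<gamma> 0) = h x \<longleftrightarrow> \<gamma> 0 = x"
    using h by (metis bij_is_inj injD)
  ultimately show ?thesis by (simp add: is_solution_def)
qed

text \<open>
  As the flow is a definite description, it is transported only where solutions are known to be
  unique; uniqueness for \<open>f\<close> follows from that for \<open>g\<close>.
\<close>
lemma flow_linear_image:
  fixes h :: "'a::euclidean_space \<Rightarrow> 'b::euclidean_space"
  assumes h: "linear h" "bij h" and conj: "\<And>v u. h (f v u) = g (h v) u"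
    and ex1: "\<exists>!\<delta>. is_solution g (h x) u \<delta>"
  shows "flow g t (h x) u = h (flow f t x u)"
proof -
  note iff = is_solution_linear_image[of h f g, OF h conj]
  obtain \<delta> where d: "is_solution g (h x) u \<delta>" "\<And>\<delta>'. is_solution g (h x) u \<delta>' \<Longrightarrow> \<delta>' = \<delta>"
    using ex1 by metis
  define \<gamma> where "\<gamma> = inv h \<circ> \<delta>"
  have hg: "h \<circ> \<gamma> = \<delta>" using h by (auto simp: \<gamma>_def surj_f_inv_f bij_is_surj)
  have "is_solution f x u \<gamma>" using d(1) iff[of x u \<gamma>] hg by simp
  moreover have "\<gamma>' = \<gamma>" if "is_solution f x u \<gamma>'" for \<gamma>'
  proof -
    have "h \<circ> \<gamma>' = h \<circ> \<gamma>" using that iff[of x u \<gamma>'] d(2) hg by simp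
    then show ?thesis using h by (metis bij_is_inj fun.inj_map_strong injD fun_eq_iff o_apply)
  qed
  ultimately have "(THE \<gamma>. is_solution f x u \<gamma>) = \<gamma>" by (rule the_equality)
  moreover have "(THE \<delta>. is_solution g (h x) u \<delta>) = \<delta>" using d by (rule the_equality)
  ultimately show ?thesis using hg by (metis flow_def o_apply)
qed

lemma
  fixes h :: "'a::euclidean_space \<Rightarrow> 'b::euclidean_space"
  assumes "\<And>t x u. u \<in> admissible \<Omega> \<Longrightarrow> flow g t (h x) u = h (flow f t x u)"
  shows pos_orbit_image: "pos_orbit g \<Omega> (h x) = h ` pos_orbit f \<Omega> x"
    and neg_orbit_image: "neg_orbit g \<Omega> (h x) = h ` neg_orbit f \<Omega> x"
proof -
  have "\<And>y. y \<in> pos_orbit g \<Omega> (h x) \<longleftrightarrow> (\<exists>t u. t \<ge> 0 \<and> u \<in> admissible \<Omega> \<and> y = h (flow f t x u))"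
    unfolding pos_orbit_def using assms by auto metis+
  then show "pos_orbit g \<Omega> (h x) = h ` pos_orbit f \<Omega> x"
    unfolding pos_orbit_def by blast
  have "\<And>y. y \<in> neg_orbit g \<Omega> (h x) \<longleftrightarrow> (\<exists>t u. t \<ge> 0 \<and> u \<in> admissible \<Omega> \<and> y = h (flow f (- t) x u))"
    unfolding neg_orbit_def using assms by auto metis+
  then show "neg_orbit g \<Omega> (h x) = h ` neg_orbit f \<Omega> x"
    unfolding neg_orbit_def by blast
qed

lemma control_set_linear_image:
  fixes h :: "'a::euclidean_space \<Rightarrow> 'b::euclidean_space"
  assumes h: "linear h" "bij h"
    and fl: "\<And>t x u. u \<in> admissible \<Omega> \<Longrightarrow> flow g t (h x) u = h (flow f t x u)"
  shows "control_set g \<Omega> (h ` D) \<longleftrightarrow> control_set f \<Omega> D"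
proof -
  have inj: "inj h" and surj: "surj h" using h by (auto simp: bij_def)
  have pre: "pre_control_set g \<Omega> (h ` D) \<longleftrightarrow> pre_control_set f \<Omega> D" for D
  proof -
    have "(\<lambda>t. flow g t (h x) u) ` {0..} \<subseteq> h ` D \<longleftrightarrow> (\<lambda>t. flow f t x u) ` {0..} \<subseteq> D"
      if "u \<in> admissible \<Omega>" for x u
      using inj by (auto simp: fl[OF that] inj_image_mem_iff image_subset_iff)
    moreover have "h ` D \<subseteq> closure (pos_orbit g \<Omega> (h x)) \<longleftrightarrow> D \<subseteq> closure (pos_orbit f \<Omega> x)" for x
      using inj h(1) by (simp add: pos_orbit_image[OF fl] closure_injective_linear_image[symmetric] inj_image_subset_iff)
    ultimately show ?thesis unfolding pre_control_set_def by auto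
  qed
  have all: "(\<forall>S. P S) \<longleftrightarrow> (\<forall>S. P (h ` S))" for P
    using surj by (metis image_f_inv_f)
  show ?thesis
    unfolding control_set_def all[of "\<lambda>D'. _ D' \<longrightarrow> D' = _"] pre
    by (simp add: inj_image_subset_iff[OF inj] inj_image_eq_iff[OF inj])
qed

text \<open>
  Both sides are the zero of the vector field for the control \<open>u\<close>, which is unique as
  \<open>det (A - u \<theta>) = \<lambda>\<^sup>2 + (\<mu> - u)\<^sup>2 > 0\<close>.
\<close>
lemma equilibrium_to_complex:
  assumes "lam \<noteq> 0"
  shows "to_complex (equilibrium (A_mat lam mu) \<eta> u) = - (of_real u * to_complex \<eta>) / Complex lam (mu - u)"
proof -
  let ?B = "A_mat lam mu - u *\<^sub>R theta"
  let ?e = "equilibrium (A_mat lam mu) \<eta> u"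
  have "det ?B = lam\<^sup>2 + (mu - u)\<^sup>2"
    by (simp add: det_2 A_mat_def theta_def power2_eq_square algebra_simps)
  moreover have "lam\<^sup>2 + (mu - u)\<^sup>2 > 0" using assms by (simp add: add_pos_nonneg)
  ultimately have "invertible ?B" unfolding invertible_det_nz by linarith
  then have inv: "?B ** matrix_inv ?B = mat 1"
    unfolding matrix_inv_def invertible_def by (rule someI_ex[THEN conjunct1])
  have "?B *v (matrix_inv ?B *v \<eta>) = \<eta>"
    by (simp add: matrix_vector_mul_assoc inv)
  then have "affine_rhs (A_mat lam mu) \<eta> ?e u = 0"
    unfolding affine_rhs_def equilibrium_def
    by (simp add: matrix_vector_mult_scaleR linear_neg[OF matrix_vector_mul_linear])
  then have "to_complex (affine_rhs (A_mat lam mu) \<eta> ?e u) = 0"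
    by (simp add: linear_0[OF linear_to_complex])
  then have "Complex lam (mu - u) * to_complex ?e = - (of_real u * to_complex \<eta>)"
    unfolding to_complex_affine_rhs rotor_rhs_def by (simp add: eq_neg_iff_add_eq_0)
  moreover have "Complex lam (mu - u) \<noteq> 0" using assms by (simp add: complex_eq_iff)
  ultimately show ?thesis by (simp add: field_simps)
qed

theorem theorem3p6:
  fixes lam mu um up :: real and \<eta> :: "real^2"
  assumes "lam\<^sup>2 + mu\<^sup>2 \<noteq> 0"
    and "\<eta> \<noteq> 0"
    and "um < 0" and "0 < up"
  shows "let A = A_mat lam mu; \<Omega> = {um..up}; f = affine_rhs A \<eta> in
    (\<exists>!C. control_set f \<Omega> C \<and> interior C \<noteq> {}) \<and>
    (\<forall>C. control_set f \<Omega> C \<and> interior C \<noteq> {} \<longrightarrow>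
       (trace A \<noteq> 0 \<longrightarrow> bounded C) \<and>
       (trace A = 0 \<longrightarrow> C = UNIV) \<and>
       (trace A < 0 \<longrightarrow> (\<forall>u\<in>\<Omega>. C = closure (pos_orbit f \<Omega> (equilibrium A \<eta> u)))) \<and>
       (trace A > 0 \<longrightarrow> (\<forall>u\<in>\<Omega>. u \<noteq> mu \<longrightarrow> C = neg_orbit f \<Omega> (equilibrium A \<eta> u))))"
proof -
  let ?h = to_complex
  define f where "f = affine_rhs (A_mat lam mu) \<eta>"
  note h = linear_to_complex bij_to_complex
  have inj: "inj ?h" using h(2) by (rule bij_is_inj)
  interpret rotor_system lam mu um up "?h \<eta>"
  proof
    show "?h \<eta> \<noteq> 0" using assms(2) inj linear_0[OF h(1)] by (metis injD)
    show "Complex lam mu \<noteq> 0" using assms(1) by (auto simp: complex_eq_iff)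
  qed (use assms in auto)
  let ?g = "rotor_rhs lam mu (?h \<eta>)"
  have fl: "\<phi> t (?h x) u = ?h (flow f t x u)" if "u \<in> adm" for t x u
    unfolding f_def
    by (rule flow_linear_image[OF h to_complex_affine_rhs ex1_solution[OF that]])
  have cs: "control_set ?g {um..up} (?h ` D) \<longleftrightarrow> control_set f {um..up} D" for D
    by (rule control_set_linear_image[OF h fl])
  have intr: "interior (?h ` D) = ?h ` interior D" for D
    using interior_bijective_linear_image[OF h] .
  have clos: "closure (?h ` D) = ?h ` closure D" for D
    using closure_injective_linear_image[OF h(1) inj] by simp
  have bdd: "bounded D" if "bounded (?h ` D)" for D
    using bounded_linear_image[OF that bounded_linear_bij(2)[OF h]]
    by (simp add: image_inv_f_f[OF inj])
  have tr: "trace (A_mat lam mu) = 2 * lam"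
    by (simp add: trace_def sum_2 A_mat_def)
  have eq: "?h (equilibrium (A_mat lam mu) \<eta> u) = equi u" if "lam \<noteq> 0" for u
    using equilibrium_to_complex[OF that] by (simp add: equi_def rate_def)
  have im_eq: "?h ` D = ?h ` D' \<longleftrightarrow> D = D'" for D D' by (rule inj_image_eq_iff[OF inj])
  consider "lam = 0" | "lam < 0" | "lam > 0" by linarith
  then have "(\<exists>!C. control_set f {um..up} C \<and> interior C \<noteq> {}) \<and>
    (\<forall>C. control_set f {um..up} C \<and> interior C \<noteq> {} \<longrightarrow>
       (lam \<noteq> 0 \<longrightarrow> bounded C) \<and> (lam = 0 \<longrightarrow> C = UNIV) \<and>
       (lam < 0 \<longrightarrow> (\<forall>u\<in>{um..up}. C = closure (pos_orbit f {um..up} (equilibrium (A_mat lam mu) \<eta> u)))) \<and>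
       (lam > 0 \<longrightarrow> (\<forall>u\<in>{um..up}. u \<noteq> mu \<longrightarrow> C = neg_orbit f {um..up} (equilibrium (A_mat lam mu) \<eta> u))))"
  proof cases
    case 1
    have "control_set f {um..up} D \<longleftrightarrow> D = UNIV" for D
      using control_set_iff_if_lam_zero[OF 1, of "?h ` D"] cs im_eq[of D UNIV] bij_is_surj[OF h(2)] by simp
    then show ?thesis using 1 by auto
  next
    case 2
    have *: "control_set f {um..up} D \<longleftrightarrow>
        D = closure (pos_orbit f {um..up} (equilibrium (A_mat lam mu) \<eta> u))" if "u \<in> {um..up}" for D u
    proof -
      have "closure (Opos (equi u)) = ?h ` closure (pos_orbit f {um..up} (equilibrium (A_mat lam mu) \<eta> u))"
        using 2 by (simp add: clos[symmetric] pos_orbit_image[OF fl, symmetric] eq)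
      then show ?thesis
        using control_set_iff_if_lam_neg[OF 2 that, of "?h ` D"] by (simp only: cs im_eq)
    qed
    let ?C = "closure (pos_orbit f {um..up} (equilibrium (A_mat lam mu) \<eta> 0))"
    have 0: "0 \<in> {um..up}" using assms by auto
    have C: "?h ` ?C = closure (Opos (equi 0))"
      using 2 by (simp add: clos[symmetric] pos_orbit_image[OF fl, symmetric] eq)
    have "interior ?C \<noteq> {}"
      using interior_closure_pos_orbit[OF 2 0] unfolding C[symmetric] intr by simp
    moreover have "bounded ?C"
      by (rule bdd) (use C bounded_pos_orbit[OF 2] in \<open>simp add: bounded_closure\<close>)
    moreover have "closure (pos_orbit f {um..up} (equilibrium (A_mat lam mu) \<eta> u)) = ?C"
      if "u \<in> {um..up}" for u
      using *[OF 0] *[OF that] by blast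
    ultimately show ?thesis using 2 unfolding *[OF 0] by auto
  next
    case 3
    have *: "control_set f {um..up} D \<and> interior D \<noteq> {} \<longleftrightarrow>
        D = neg_orbit f {um..up} (equilibrium (A_mat lam mu) \<eta> u)" if "u \<in> {um..up}" "u \<noteq> mu" for D u
    proof -
      have "Oneg (equi u) = ?h ` neg_orbit f {um..up} (equilibrium (A_mat lam mu) \<eta> u)"
        using 3 by (simp add: neg_orbit_image[OF fl, symmetric] eq)
      then show ?thesis
        using control_set_iff_if_lam_pos[OF 3 that, of "?h ` D"] by (simp add: cs im_eq intr)
    qed
    obtain c where c: "c \<in> {um..up}" "c \<noteq> mu" using exists_regular_control by blast
    have "?h ` neg_orbit f {um..up} (equilibrium (A_mat lam mu) \<eta> c) = Oneg (equi c)"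
      using 3 by (simp add: neg_orbit_image[OF fl, symmetric] eq)
    then have "bounded (neg_orbit f {um..up} (equilibrium (A_mat lam mu) \<eta> c))"
      using bdd bounded_neg_orbit[OF 3] by metis
    moreover have "neg_orbit f {um..up} (equilibrium (A_mat lam mu) \<eta> u) =
        neg_orbit f {um..up} (equilibrium (A_mat lam mu) \<eta> c)" if "u \<in> {um..up}" "u \<noteq> mu" for u
      using *[OF c] *[OF that] by blast
    ultimately show ?thesis using 3 unfolding *[OF c] by auto
  qed
  moreover have signs: "2 * lam = 0 \<longleftrightarrow> lam = 0" "2 * lam < 0 \<longleftrightarrow> lam < 0" "2 * lam > 0 \<longleftrightarrow> lam > 0"
    by auto
  ultimately show ?thesis unfolding Let_def tr f_def signs by blast
qed

end
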